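(* Let $N\ge1$ be an integer, $c>0$, and let $a<0<b$ be integers. The pseudo-distribution of $S_{ab}$ is given, for $\ell\in\{0,1,\dots,N-1\}$, by $$\mathbb{P}\{S_{ab}=a-\ell,\ \sigma_{ab}<+\infty\}=(-1)^\ell\,\frac{KN}{\ell-a}\binom{N-1}{\ell}\Big/\binom{\ell+b-a+N-1}{N},$$ $$\mathbb{P}\{S_{ab}=b+\ell,\ \sigma_{ab}<+\infty\}=(-1)^\ell\,\frac{KN}{\ell+b}\binom{N-1}{\ell}\Big/\binom{\ell+b-a+N-1}{N},$$ where $$K=\binom{N-a-1}{N}\binom{N+b-1}{N}=\frac{(-1)^N}{(N!)^2}\,a(a-1)\cdots(a-N+1)\,b(b+1)\cdots(b+N-1).$$ Moreover, $\mathbb{P}\{\sigma_{ab}<+\infty\}=1$ and $$\mathbb{P}\{\sigma_b^+<\sigma_a^-\}=KN^2\iint_{\mathcal{D}^+}u^{-a-1}(1-u)^{N-1}v^{b-1}(1-v)^{N-1}\,\mathrm{d}u\,\mathrm{d}v,$$ $$\mathbb{P}\{\sigma_a^-<\sigma_b^+\}=KN^2\iint_{\mathcal{D}^-}u^{-a-1}(1-u)^{N-1}v^{b-1}(1-v)^{N-1}\,\mathrm{d}u\,\mathrm{d}v,$$ where $\mathcal{D}^+=\{(u,v)\in\mathbb{R}^2:0\le v\le u\le1\}$ and $\mathcal{D}^-=\{(u,v)\in\mathbb{R}^2:0\le u\le v\le1\}$.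
   Context: Pseudo-random walk: put $p_k=\delta_{k0}+(-1)^{k-1}c\binom{2N}{k+N}$ for $k\in\{-N,\dots,N\}$ (real numbers, possibly negative, summing to $1$) and $p_k=0$ for other integers $k$. The $U_n$, $n\ge1$, are i.i.d. pseudo-random variables with $\mathbb{P}\{U_n=k\}=p_k$, i.e. $\mathbb{P}\{U_1=k_1,\dots,U_n=k_n\}=p_{k_1}\cdots p_{k_n}$ (a signed measure of total mass one); $S_0=0$, $S_n=U_1+\dots+U_n$. Times: $\sigma_a^-=\min\{n\ge1:S_n\le a\}$, $\sigma_b^+=\min\{n\ge1:S_n\ge b\}$, $\sigma_{ab}=\min\{n\ge1:S_n\le a\text{ or }S_n\ge b\}$ ($\min\emptyset=+\infty$), $S_{ab}=S_{\sigma_{ab}}\in\mathcal{E}=\{a-N+1,\dots,a\}\cup\{b,\dots,b+N-1\}$; $\mathbb{P}\{\sigma_{ab}=k,S_{ab}=\ell\}=\mathbb{P}\{S_1\in(a,b),\dots,S_{k-1}\in(a,b),S_k=\ell\}$ for $k\ge1$. Meaning of the pseudo-probabilities: let $M_1=\sum_{k=-N}^N|p_k|$ and $H_{ab,\ell}(z)=\sum_{k\ge1}\mathbb{P}\{\sigma_{ab}=k,S_{ab}=\ell\}z^k$, absolutely convergent for $|z|<1/M_1$; $H_{ab,\ell}$ extends (uniquely) to a real-analytic function on $(0,1)$, still denoted $H_{ab,\ell}$. Then $\mathbb{P}\{S_{ab}=\ell,\sigma_{ab}<+\infty\}=H_{ab,\ell}(1):=\lim_{z\to1^-}H_{ab,\ell}(z)$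 (existence of the limit being part of the assertion), $\mathbb{P}\{\sigma_{ab}<+\infty\}=\sum_{\ell\in\mathcal{E}}\mathbb{P}\{S_{ab}=\ell,\sigma_{ab}<+\infty\}$, $\mathbb{P}\{\sigma_b^+<\sigma_a^-\}=\sum_{\ell=b}^{b+N-1}\mathbb{P}\{S_{ab}=\ell,\sigma_{ab}<+\infty\}$ and $\mathbb{P}\{\sigma_a^-<\sigma_b^+\}=\sum_{\ell=a-N+1}^{a}\mathbb{P}\{S_{ab}=\ell,\sigma_{ab}<+\infty\}$. *)

theory Defs
  imports "HOL-Analysis.Analysis"
begin

definition step_mass :: "nat \<Rightarrow> real \<Rightarrow> int \<Rightarrow> real" where
  "step_mass N c k =
     (if k \<in> {- int N..int N}
      then (if k = 0 then 1 else 0) + (-1) powi (k - 1) * c * real ((2 * N) choose nat (k + int N))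
      else 0)"

definition walk :: "(nat \<Rightarrow> int) \<Rightarrow> nat \<Rightarrow> int" where
  "walk u n = (\<Sum>j=1..n. u j)"

text \<open>
  The signed mass of an event \<open>E\<close> that only depends on the first \<open>n\<close> steps \<open>u 1, \<dots>, u n\<close>.
  Tuples with an entry outside \<open>{- N..N}\<close> have mass zero, so the sum is a finite one.
\<close>

definition pseudo_prob :: "nat \<Rightarrow> real \<Rightarrow> nat \<Rightarrow> ((nat \<Rightarrow> int) \<Rightarrow> bool) \<Rightarrow> real" where
  "pseudo_prob N c n E =
     (\<Sum>u | u \<in> {1..n} \<rightarrow>\<^sub>E {- int N..int N} \<and> E u. \<Prod>j=1..n. step_mass N c (u j))"

text \<open>The infimum of the empty set is \<open>\<infinity>\<close> in \<^typ>\<open>enat\<close>.\<close>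

definition time_below :: "int \<Rightarrow> (nat \<Rightarrow> int) \<Rightarrow> enat" where
  "time_below a u = (INF n \<in> {n. 1 \<le> n \<and> walk u n \<le> a}. enat n)"

definition time_above :: "int \<Rightarrow> (nat \<Rightarrow> int) \<Rightarrow> enat" where
  "time_above b u = (INF n \<in> {n. 1 \<le> n \<and> walk u n \<ge> b}. enat n)"

definition exit_time :: "int \<Rightarrow> int \<Rightarrow> (nat \<Rightarrow> int) \<Rightarrow> enat" where
  "exit_time a b u = (INF n \<in> {n. 1 \<le> n \<and> (walk u n \<le> a \<or> walk u n \<ge> b)}. enat n)"

definition exit_pos :: "int \<Rightarrow> int \<Rightarrow> (nat \<Rightarrow> int) \<Rightarrow> int" where
  "exit_pos a b u = walk u (the_enat (exit_time a b u))"

definition exit_set :: "nat \<Rightarrow> int \<Rightarrow> int \<Rightarrow> int set" where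
  "exit_set N a b = {a - int N + 1..a} \<union> {b..b + int N - 1}"

definition exit_mass :: "nat \<Rightarrow> real \<Rightarrow> int \<Rightarrow> int \<Rightarrow> nat \<Rightarrow> int \<Rightarrow> real" where
  "exit_mass N c a b k l =
     pseudo_prob N c k (\<lambda>u. exit_time a b u = enat k \<and> exit_pos a b u = l)"

lemma INF_enat_eq_iff:
  "(INF n \<in> A. enat n) = enat k \<longleftrightarrow> k \<in> A \<and> (\<forall>j<k. j \<notin> A)"
proof
  assume eq: "(INF n \<in> A. enat n) = enat k"
  then have "enat ` A \<noteq> {}"
    by (auto simp: top_enat_def)
  then have "Inf (enat ` A) \<in> enat ` A"
    by (meson ex_in_conv wellorder_InfI)
  with eq have "k \<in> A" by auto
  moreover have "j \<notin> A" if "j < k" for j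
  proof
    assume "j \<in> A"
    then have "(INF n \<in> A. enat n) \<le> enat j" by (rule INF_lower)
    with eq that show False by simp
  qed
  ultimately show "k \<in> A \<and> (\<forall>j<k. j \<notin> A)" by blast
next
  assume "k \<in> A \<and> (\<forall>j<k. j \<notin> A)"
  then show "(INF n \<in> A. enat n) = enat k"
    by (intro antisym INF_lower INF_greatest) (auto simp: not_less[symmetric])
qed

lemma exit_mass_eq:
  assumes "1 \<le> k" and "l \<le> a \<or> b \<le> l"
  shows "exit_mass N c a b k l =
    pseudo_prob N c k (\<lambda>u. (\<forall>j\<in>{1..<k}. walk u j \<in> {a<..<b}) \<and> walk u k = l)"
proof -
  have "(exit_time a b u = enat k \<and> exit_pos a b u = l) \<longleftrightarrow>
        (\<forall>j\<in>{1..<k}. walk u j \<in> {a<..<b}) \<and> walk u k = l" for u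
  proof -
    have time: "exit_time a b u = enat k \<longleftrightarrow>
        (walk u k \<le> a \<or> walk u k \<ge> b) \<and> (\<forall>j\<in>{1..<k}. walk u j \<in> {a<..<b})"
      using assms(1) unfolding exit_time_def INF_enat_eq_iff by (force simp: not_le)
    have "exit_pos a b u = walk u k" if "exit_time a b u = enat k"
      by (simp add: exit_pos_def that)
    with time assms(2) show ?thesis by metis
  qed
  then show ?thesis by (simp add: exit_mass_def)
qed

text \<open>
  \<open>M\<^sub>1 \<ge> 1\<close> because the \<^const>\<open>step_mass\<close> sums to one.  The generating function of the
  masses, given by its power series on \<open>(0, 1/M\<^sub>1)\<close>, has at most one real-analytic extension
  to \<open>(0, 1)\<close>; values of \<open>H\<close> outside \<open>(0, 1)\<close> are irrelevant.
\<close>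

definition abs_mass :: "nat \<Rightarrow> real \<Rightarrow> real" where
  "abs_mass N c = (\<Sum>k=- int N..int N. \<bar>step_mass N c k\<bar>)"

definition real_analytic_on :: "(real \<Rightarrow> real) \<Rightarrow> real set \<Rightarrow> bool" where
  "real_analytic_on f S \<longleftrightarrow> (\<forall>x\<in>S. \<exists>F. (\<lambda>h. f (x + h)) has_fps_expansion F)"

definition is_exit_gf :: "nat \<Rightarrow> real \<Rightarrow> int \<Rightarrow> int \<Rightarrow> int \<Rightarrow> (real \<Rightarrow> real) \<Rightarrow> bool" where
  "is_exit_gf N c a b l H \<longleftrightarrow>
     real_analytic_on H {0<..<1} \<and>
     (\<forall>z\<in>{0<..<1 / abs_mass N c}. (\<lambda>k. exit_mass N c a b (Suc k) l * z ^ Suc k) sums H z)"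

definition has_exit_prob :: "nat \<Rightarrow> real \<Rightarrow> int \<Rightarrow> int \<Rightarrow> int \<Rightarrow> real \<Rightarrow> bool" where
  "has_exit_prob N c a b l p \<longleftrightarrow> (\<exists>H. is_exit_gf N c a b l H \<and> (H \<longlongrightarrow> p) (at_left 1))"

text \<open>
  The pseudo-probability that the walk exits at \<open>l\<close> in finite time; meaningful only when
  \<open>\<exists>!p. has_exit_prob N c a b l p\<close>.
\<close>

definition exit_prob :: "nat \<Rightarrow> real \<Rightarrow> int \<Rightarrow> int \<Rightarrow> int \<Rightarrow> real" where
  "exit_prob N c a b l = (THE p. has_exit_prob N c a b l p)"

definition prob_exit_finite :: "nat \<Rightarrow> real \<Rightarrow> int \<Rightarrow> int \<Rightarrow> real" where
  "prob_exit_finite N c a b = (\<Sum>l\<in>exit_set N a b. exit_prob N c a b l)"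

text \<open>
  The events \<open>\<sigma>\<^sub>b\<^sup>+ < \<sigma>\<^sub>a\<^sup>-\<close> and \<open>\<sigma>\<^sub>a\<^sup>- < \<sigma>\<^sub>b\<^sup>+\<close> are exits through the upper and the lower part of
  \<^const>\<open>exit_set\<close>, see \<open>above_before_below_iff\<close> and \<open>below_before_above_iff\<close>.
\<close>

definition prob_above_before_below :: "nat \<Rightarrow> real \<Rightarrow> int \<Rightarrow> int \<Rightarrow> real" where
  "prob_above_before_below N c a b = (\<Sum>l=b..b + int N - 1. exit_prob N c a b l)"

definition prob_below_before_above :: "nat \<Rightarrow> real \<Rightarrow> int \<Rightarrow> int \<Rightarrow> real" where
  "prob_below_before_above N c a b = (\<Sum>l=a - int N + 1..a. exit_prob N c a b l)"

lemma exit_time_eq_inf: "exit_time a b u = inf (time_below a u) (time_above b u)"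
proof -
  have "{n. 1 \<le> n \<and> (walk u n \<le> a \<or> walk u n \<ge> b)} =
        {n. 1 \<le> n \<and> walk u n \<le> a} \<union> {n. 1 \<le> n \<and> walk u n \<ge> b}" by auto
  then show ?thesis
    unfolding exit_time_def time_below_def time_above_def by (simp only: INF_union)
qed

lemma exit_step:
  assumes ab: "a < 0" "0 < b" and u: "\<And>j. \<bar>u j\<bar> \<le> int N" and k: "exit_time a b u = enat k"
  shows "walk u k \<in> exit_set N a b"
proof -
  from k have *: "1 \<le> k" "walk u k \<le> a \<or> walk u k \<ge> b"
    and less: "\<And>j. j < k \<Longrightarrow> 1 \<le> j \<Longrightarrow> a < walk u j \<and> walk u j < b"
    unfolding exit_time_def INF_enat_eq_iff by auto
  from * obtain m where m: "k = Suc m" by (cases k) auto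
  have "a < walk u m \<and> walk u m < b"
    using less[of m] ab m by (cases m) (auto simp: walk_def)
  moreover have "walk u k = walk u m + u k" by (simp add: walk_def m)
  ultimately show ?thesis using u[of k] *(2) by (auto simp: exit_set_def)
qed

lemma above_before_below_iff:
  assumes "a < 0" "0 < b" "\<And>j. \<bar>u j\<bar> \<le> int N"
  shows "time_above b u < time_below a u \<longleftrightarrow>
         exit_time a b u < \<infinity> \<and> exit_pos a b u \<in> {b..b + int N - 1}"
proof (cases "exit_time a b u")
  case (enat k)
  note st = exit_step[OF assms enat]
  have ab: "a < b" using assms by simp
  have pos: "exit_pos a b u = walk u k" by (simp add: exit_pos_def enat)
  have mn: "min (time_below a u) (time_above b u) = enat k"
    using enat by (simp add: exit_time_eq_inf inf_min)
  have B: "walk u k \<le> a" if "time_below a u = enat k"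
    using that unfolding time_below_def INF_enat_eq_iff by simp
  have A: "walk u k \<ge> b" if "time_above b u = enat k"
    using that unfolding time_above_def INF_enat_eq_iff by simp
  show ?thesis
  proof
    assume l: "time_above b u < time_below a u"
    with mn A have "walk u k \<ge> b" by (simp add: min_def split: if_splits)
    with st ab show "exit_time a b u < \<infinity> \<and> exit_pos a b u \<in> {b..b + int N - 1}"
      by (auto simp: enat pos exit_set_def)
  next
    assume "exit_time a b u < \<infinity> \<and> exit_pos a b u \<in> {b..b + int N - 1}"
    with pos ab B have "time_below a u \<noteq> enat k" by force
    with mn show "time_above b u < time_below a u"
      by (auto simp: min_def split: if_splits)
  qed
next
  case infinity
  then have "time_above b u = \<infinity>"
    by (auto simp: exit_time_eq_inf inf_min min_def split: if_splits)
  with infinity show ?thesis by simp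
qed

lemma below_before_above_iff:
  assumes "a < 0" "0 < b" "\<And>j. \<bar>u j\<bar> \<le> int N"
  shows "time_below a u < time_above b u \<longleftrightarrow>
         exit_time a b u < \<infinity> \<and> exit_pos a b u \<in> {a - int N + 1..a}"
proof (cases "exit_time a b u")
  case (enat k)
  note st = exit_step[OF assms enat]
  have ab: "a < b" using assms by simp
  have pos: "exit_pos a b u = walk u k" by (simp add: exit_pos_def enat)
  have mn: "min (time_below a u) (time_above b u) = enat k"
    using enat by (simp add: exit_time_eq_inf inf_min)
  have B: "walk u k \<le> a" if "time_below a u = enat k"
    using that unfolding time_below_def INF_enat_eq_iff by simp
  have A: "walk u k \<ge> b" if "time_above b u = enat k"
    using that unfolding time_above_def INF_enat_eq_iff by simp
  show ?thesis
  proof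
    assume l: "time_below a u < time_above b u"
    with mn B have "walk u k \<le> a" by (simp add: min_def split: if_splits)
    with st ab show "exit_time a b u < \<infinity> \<and> exit_pos a b u \<in> {a - int N + 1..a}"
      by (auto simp: enat pos exit_set_def)
  next
    assume "exit_time a b u < \<infinity> \<and> exit_pos a b u \<in> {a - int N + 1..a}"
    with pos ab A have "time_above b u \<noteq> enat k" by force
    with mn show "time_below a u < time_above b u"
      by (auto simp: min_def split: if_splits)
  qed
next
  case infinity
  then have "time_below a u = \<infinity>"
    by (auto simp: exit_time_eq_inf inf_min min_def split: if_splits)
  with infinity show ?thesis by simp
qed

definition exit_const :: "nat \<Rightarrow> int \<Rightarrow> int \<Rightarrow> real" where
  "exit_const N a b =
     real (nat (int N - a - 1) choose N) * real (nat (int N + b - 1) choose N)"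

end

theory Submission
  imports
    Defs
    "Jordan_Normal_Form.Determinant"
    "HOL-Complex_Analysis.Cauchy_Integral_Formula"
begin

text \<open>
  One step of the walk acts on functions by \<open>f(x) \<mapsto> \<Sum>\<^sub>k p\<^sub>k f(x + k) = f(x) - c (-1)\<^sup>N (\<Delta>\<^sup>2\<^sup>N f)(x - N)\<close>, where
  \<open>\<Delta>\<close> is the forward difference.  Two properties of the operator \<open>(-1)\<^sup>N \<Delta>\<^sup>2\<^sup>N\<close>, shifted by \<open>N\<close>, carry the proof.

  It is positive definite, being the product of an \<open>N\<close>-th difference operator and its transpose.
  Let \<open>Q\<close> be the matrix of the step restricted to the points strictly between \<open>a\<close> and \<open>b\<close>.  Then
  \<open>\<langle>v, (I - z Q) v\<rangle> = (1 - z) \<parallel>v\<parallel>\<^sup>2 + z c \<parallel>\<Delta>\<^sup>N v\<parallel>\<^sup>2\<close>, so \<open>I - z Q\<close> is invertible for every \<open>z\<close> in \<open>[0, 1]\<close>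
  (\<open>killed_walk_resolvent_injective\<close>), and by Cramer's rule its inverse consists of rational functions without poles there
  (\<open>rational_resolvent_row\<close>).  For small \<open>z\<close> the Neumann series shows that the generating function of the exits at
  \<open>l\<close> is a combination of such entries (\<open>green_series\<close>); hence it continues to \<open>(0, 1]\<close>, uniquely by the
  identity theorem (\<open>real_analytic_identity\<close>), and the limit at \<open>1\<close> is just the value there.

  It annihilates the polynomials of degree less than \<open>2N\<close>, which are therefore harmonic
  (\<open>step_mass_mean_value\<close>).  Optional stopping at \<open>z = 1\<close> then gives \<open>\<Sum>\<^sub>l P(l) h(l) = h(0)\<close> for all such \<open>h\<close>, where
  \<open>l\<close> ranges over the exit set and \<open>P(l)\<close> is the pseudo-probability of the exit at \<open>l\<close>
  (\<open>exit_prob_exists\<close>).  Since the exit set has \<open>2N\<close> points, the \<open>P(l)\<close> are the Lagrange interpolation weights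
  at \<open>0\<close> with these nodes (\<open>exit_prob_lagrange\<close>), which are the stated quotients of binomial coefficients;
  the constant polynomial gives total mass one.

  The double integrals are evaluated by expanding one factor \<open>(1 - v)\<^sup>N\<^sup>-\<^sup>1\<close> by the binomial theorem: each
  term leaves a beta integral and equals, up to the common constant, one of the exit
  probabilities (\<open>beta_density_lower_triangle\<close>).
\<close>

section \<open>Positivity and harmonic polynomials of the step operator\<close>

text \<open>
  Binomial coefficients with an integer lower index, zero outside Pascal's triangle.  Translating a
  row then needs no case distinction at its ends.
\<close>
definition binom_int :: "nat \<Rightarrow> int \<Rightarrow> real" where
  "binom_int n k = (if k < 0 then 0 else real (n choose nat k))"

lemma binom_int_of_nat [simp]: "binom_int n (int k) = real (n choose k)"
  by (simp add: binom_int_def)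

lemma binom_int_eq_0: "k < 0 \<or> int n < k \<Longrightarrow> binom_int n k = 0"
  by (auto simp: binom_int_def)

lemma binom_int_symmetric: "binom_int n (int n - k) = binom_int n k"
proof (cases "0 \<le> k \<and> k \<le> int n")
  case True
  then have "nat (int n - k) = n - nat k" "nat k \<le> n" by auto
  with True show ?thesis by (simp add: binom_int_def binomial_symmetric[of "nat k" n])
qed (auto simp: binom_int_eq_0)

lemma image_int_atMost: "(\<lambda>j. k + int j) ` {..n} = {k..k + int n}"
proof -
  have "y \<in> (\<lambda>j. k + int j) ` {..n}" if "y \<in> {k..k + int n}" for y
    using that by (intro image_eqI[of _ _ "nat (y - k)"]) auto
  then show ?thesis by auto
qed

text \<open>
  The cut-off at \<open>\<plusminus>N\<close> is built into the binomial coefficient, so one step of the walk is the identity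
  minus \<open>c\<close> times the operator with kernel \<open>(-1)\<^sup>k\<close> \<open>binom (2N) (k + N)\<close>, which is the \<open>2N\<close>-th difference
  operator up to a shift and the sign \<open>(-1)\<^sup>N\<close>.
\<close>
lemma step_mass_eq:
  "step_mass N c k = (if k = 0 then 1 else 0) - c * (-1) powi k * binom_int (2 * N) (k + int N)"
proof -
  have "(-1) powi (k - 1) = - ((-1) powi k :: real)"
    by (simp add: power_int_minus_left)
  then show ?thesis
    by (auto simp: step_mass_def binom_int_def)
qed

lemma step_mass_eq_0: "\<not> \<bar>k\<bar> \<le> int N \<Longrightarrow> step_mass N c k = 0"
  by (auto simp: step_mass_def)

lemma binom_int_vandermonde:
  assumes "finite S" "{x..x + int N} \<subseteq> S"
  shows "(\<Sum>s\<in>S. binom_int N (s - x) * binom_int N (s - y)) = binom_int (2 * N) (y - x + int N)"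
proof -
  define r where "r = int N + y - x"
  define T where "T = {..N + nat r}"
  have sub: "(\<lambda>i. x + int i) ` {..N} = {x..x + int N}"
    by (rule image_int_atMost)
  have "(\<Sum>s\<in>S. binom_int N (s - x) * binom_int N (s - y)) =
        (\<Sum>s\<in>{x..x + int N}. binom_int N (s - x) * binom_int N (s - y))"
    using assms by (intro sum.mono_neutral_right) (auto simp: binom_int_eq_0)
  also have "\<dots> = (\<Sum>i\<le>N. real (N choose i) * binom_int N (x + int i - y))"
    unfolding sub[symmetric] by (subst sum.reindex) (auto simp: inj_on_def o_def)
  also have "\<dots> = (\<Sum>i\<le>N. real (N choose i) * binom_int N (r - int i))"
    using binom_int_symmetric[of N "x + int _ - y"]
    by (intro sum.cong refl) (simp add: r_def algebra_simps)
  also have "\<dots> = binom_int (2 * N) r"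
  proof (cases "r < 0")
    case False
    have "(\<Sum>i\<le>N. real (N choose i) * binom_int N (r - int i)) =
          (\<Sum>i\<in>T. real (N choose i) * binom_int N (r - int i))"
      by (intro sum.mono_neutral_left) (auto simp: T_def)
    also have "\<dots> = (\<Sum>i\<le>nat r. real (N choose i) * binom_int N (r - int i))"
      by (intro sum.mono_neutral_right) (auto simp: T_def binom_int_def)
    also have "\<dots> = (\<Sum>i\<le>nat r. real ((N choose i) * (N choose (nat r - i))))"
      using False by (intro sum.cong) (auto simp: binom_int_def nat_diff_distrib)
    also have "\<dots> = real ((N + N) choose nat r)"
      by (simp only: of_nat_sum[symmetric] vandermonde)
    finally show ?thesis using False by (simp add: binom_int_def mult_2)
  qed (simp add: binom_int_def)
  finally show ?thesis by (simp add: r_def algebra_simps)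
qed

text \<open>
  By Vandermonde's identity the kernel \<open>(-1)\<^sup>k\<close> \<open>binom (2N) (k + N)\<close> is a Gram matrix: it is the product
  of the \<open>N\<close>-th difference operator with its transpose, the intermediate points \<open>s\<close> ranging over
  everything that \<open>I\<close> reaches.  This is the positivity that replaces \<open>p\<^sub>k \<ge> 0\<close> for this signed walk.
\<close>
lemma step_form_sum_squares:
  assumes "finite S" "finite I" "\<And>x. x \<in> I \<Longrightarrow> {x..x + int N} \<subseteq> S"
  shows "(\<Sum>x\<in>I. \<Sum>y\<in>I. v x * step_mass N c (y - x) * v y) =
         (\<Sum>x\<in>I. (v x)\<^sup>2) - c * (\<Sum>s\<in>S. (\<Sum>x\<in>I. (-1) powi x * v x * binom_int N (s - x))\<^sup>2)"
proof -
  let ?b = "\<lambda>s x. (-1) powi x * v x * binom_int N (s - x)"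
  have sgn: "(-1) powi (y - x) = ((-1) powi x * (-1) powi y :: real)" for x y :: int
    by (simp add: power_int_minus_left)
  have "(\<Sum>s\<in>S. (\<Sum>x\<in>I. ?b s x)\<^sup>2) = (\<Sum>s\<in>S. \<Sum>x\<in>I. \<Sum>y\<in>I. ?b s x * ?b s y)"
    by (simp add: power2_eq_square sum_product)
  also have "\<dots> = (\<Sum>x\<in>I. \<Sum>s\<in>S. \<Sum>y\<in>I. ?b s x * ?b s y)" by (rule sum.swap)
  also have "\<dots> = (\<Sum>x\<in>I. \<Sum>y\<in>I. \<Sum>s\<in>S. ?b s x * ?b s y)"
    by (intro sum.cong refl sum.swap)
  also have "\<dots> = (\<Sum>x\<in>I. \<Sum>y\<in>I. v x * ((-1) powi (y - x) * binom_int (2 * N) (y - x + int N)) * v y)"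
  proof (intro sum.cong refl)
    fix x y assume "x \<in> I"
    have "(\<Sum>s\<in>S. ?b s x * ?b s y) = ((-1) powi x * (-1) powi y) * v x * v y *
        (\<Sum>s\<in>S. binom_int N (s - x) * binom_int N (s - y))"
      by (simp add: sum_distrib_left algebra_simps)
    also have "\<dots> = v x * ((-1) powi (y - x) * binom_int (2 * N) (y - x + int N)) * v y"
      unfolding binom_int_vandermonde[OF assms(1) assms(3)[OF \<open>x \<in> I\<close>]] sgn by simp
    finally show "(\<Sum>s\<in>S. ?b s x * ?b s y) = \<dots>" .
  qed
  finally have sq: "(\<Sum>s\<in>S. (\<Sum>x\<in>I. ?b s x)\<^sup>2) = \<dots>" .
  have "(\<Sum>x\<in>I. \<Sum>y\<in>I. v x * step_mass N c (y - x) * v y) =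
    (\<Sum>x\<in>I. \<Sum>y\<in>I. (if y = x then v x * v y else 0) -
       c * (v x * ((-1) powi (y - x) * binom_int (2 * N) (y - x + int N)) * v y))"
    by (intro sum.cong refl) (simp add: step_mass_eq algebra_simps)
  also have "\<dots> = (\<Sum>x\<in>I. (v x)\<^sup>2) - c * (\<Sum>s\<in>S. (\<Sum>x\<in>I. ?b s x)\<^sup>2)"
    unfolding sq using assms(2) by (simp add: sum_subtractf sum_distrib_left power2_eq_square)
  finally show ?thesis .
qed

text \<open>
  The transform is triangular with nonzero diagonal: at the smallest \<open>s\<close> where \<open>v\<close> does not vanish,
  all other terms are zero, those above \<open>s\<close> because their binomial coefficient has a negative index.
\<close>
lemma binomial_transform_injective:
  assumes "finite I"
    and zero: "\<And>s. s \<in> I \<Longrightarrow> (\<Sum>x\<in>I. (-1) powi x * v x * binom_int N (s - x)) = 0"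
  shows "\<forall>x\<in>I. v x = 0"
proof (rule ccontr)
  assume "\<not> ?thesis"
  then have ne: "{x\<in>I. v x \<noteq> 0} \<noteq> {}" by auto
  define s where "s = Min {x\<in>I. v x \<noteq> 0}"
  have s: "s \<in> I" "v s \<noteq> 0" using Min_in[OF _ ne] assms(1) by (auto simp: s_def)
  have less: "v x = 0" if "x \<in> I" "x < s" for x
    using that assms(1) Min_le[of "{x\<in>I. v x \<noteq> 0}" x] unfolding s_def
    by (metis (mono_tags, lifting) finite_subset mem_Collect_eq not_le subsetI)
  have "0 = (\<Sum>x\<in>I. (-1) powi x * v x * binom_int N (s - x))" using zero[OF s(1)] by simp
  also have "\<dots> = (\<Sum>x\<in>I. if x = s then (-1) powi x * v x else 0)"
    using less by (intro sum.cong refl) (auto simp: binom_int_def not_less order.order_iff_strict)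
  also have "\<dots> = (-1) powi s * v s" using s(1) assms(1) by simp
  finally show False using s(2) by simp
qed

text \<open>
  Pairing the equation with \<open>v\<close> gives \<open>(1 - z) \<parallel>v\<parallel>\<^sup>2 + z c \<parallel>w\<parallel>\<^sup>2 = 0\<close>, where \<open>w\<close> is the \<open>N\<close>-th difference
  of \<open>v\<close>.  Both terms are nonnegative on \<open>[0, 1]\<close>, also at the end point \<open>z = 1\<close>, where only the
  second one remains.
\<close>
lemma killed_walk_resolvent_injective:
  assumes fin: "finite I" and c: "0 < c" and z: "z \<in> {0..1}"
    and v: "\<forall>x\<in>I. v x = z * (\<Sum>y\<in>I. step_mass N c (y - x) * v y)"
  shows "\<forall>x\<in>I. v x = 0"
proof -
  define S where "S = (\<Union>x\<in>I. {x..x + int N})"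
  have S: "finite S" "\<And>x. x \<in> I \<Longrightarrow> {x..x + int N} \<subseteq> S" using fin by (auto simp: S_def)
  let ?w = "\<lambda>s. \<Sum>x\<in>I. (-1) powi x * v x * binom_int N (s - x)"
  define T W V where "T = (\<Sum>x\<in>I. \<Sum>y\<in>I. v x * step_mass N c (y - x) * v y)"
    and "W = (\<Sum>s\<in>S. (?w s)\<^sup>2)" and "V = (\<Sum>x\<in>I. (v x)\<^sup>2)"
  have "V = (\<Sum>x\<in>I. v x * (z * (\<Sum>y\<in>I. step_mass N c (y - x) * v y)))"
    using v unfolding V_def by (intro sum.cong) (auto simp: power2_eq_square)
  also have "\<dots> = z * T"
    by (simp add: T_def sum_distrib_left algebra_simps)
  also have "T = V - c * W"
    using step_form_sum_squares[OF S(1) fin S(2), of v c] by (simp add: T_def V_def W_def)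
  finally have eq: "(1 - z) * V + z * c * W = 0" by (simp add: algebra_simps)
  have nn: "0 \<le> (1 - z) * V" "0 \<le> z * c * W"
    using z c by (auto simp: V_def W_def intro!: mult_nonneg_nonneg sum_nonneg)
  show ?thesis
  proof (cases "z = 0")
    case True
    then show ?thesis using v by simp
  next
    case False
    then have "W = 0" using eq nn c by (simp add: add_nonneg_eq_0_iff)
    then have "\<forall>s\<in>S. ?w s = 0" using S(1) by (simp add: W_def sum_nonneg_eq_0_iff)
    then show ?thesis using S(2) by (intro binomial_transform_injective[OF fin]) force
  qed
qed

text \<open>
  The sum is an \<open>n\<close>-th difference, up to sign; by Pascal's rule it is the \<open>(n-1)\<close>-st difference
  of \<open>g(x) - g(x + 1)\<close>, whose degree is smaller than that of \<open>g\<close>.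
\<close>
lemma alternating_binomial_sum_poly:
  fixes g :: "real poly"
  assumes "degree g < n"
  shows "(\<Sum>j\<le>n. (-1) ^ j * real (n choose j) * poly g (x + real j)) = 0"
  using assms
proof (induction n arbitrary: g)
  case (Suc n)
  let ?f = "\<lambda>j. poly g (x + real j)"
  define d where "d = g - pcompose g [:1, 1:]"
  have d: "poly d (x + real j) = ?f j - ?f (Suc j)" for j
    by (simp add: d_def poly_pcompose algebra_simps)
  have "(\<Sum>j\<le>Suc n. (-1) ^ j * real (Suc n choose j) * ?f j) =
     ?f 0 + (\<Sum>j\<le>n. (-1) ^ Suc j * (real (n choose j) + real (n choose Suc j)) * ?f (Suc j))"
    by (subst sum.atMost_Suc_shift) simp
  also have "\<dots> = (?f 0 + (\<Sum>j\<le>n. (-1) ^ Suc j * real (n choose Suc j) * ?f (Suc j)))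
       - (\<Sum>j\<le>n. (-1) ^ j * real (n choose j) * ?f (Suc j))"
    by (simp add: algebra_simps sum.distrib sum_subtractf sum_negf)
  also have "?f 0 + (\<Sum>j\<le>n. (-1) ^ Suc j * real (n choose Suc j) * ?f (Suc j)) =
     (\<Sum>j\<le>Suc n. (-1) ^ j * real (n choose j) * ?f j)"
    by (subst sum.atMost_Suc_shift) simp
  also have "\<dots> = (\<Sum>j\<le>n. (-1) ^ j * real (n choose j) * ?f j)" by simp
  also have "\<dots> - (\<Sum>j\<le>n. (-1) ^ j * real (n choose j) * ?f (Suc j)) =
     (\<Sum>j\<le>n. (-1) ^ j * real (n choose j) * poly d (x + real j))"
    by (simp add: d algebra_simps sum_subtractf)
  also have "\<dots> = 0"
  proof (cases "d = 0")
    case False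
    have "degree d < degree g"
    proof -
      have deg: "degree (pcompose g [:1, 1:]) = degree g" by (simp add: degree_pcompose)
      have lead: "coeff (pcompose g [:1, 1:]) (degree g) = coeff g (degree g)"
        using lead_coeff_comp[of "[:1, 1:]" g] by (simp add: deg)
      have "coeff d (degree g) = 0" by (simp add: d_def lead)
      moreover have "degree d \<le> degree g" by (simp add: d_def degree_diff_le deg)
      ultimately show ?thesis using False
        by (metis le_neq_implies_less leading_coeff_0_iff)
    qed
    then show ?thesis using Suc by simp
  qed simp
  finally show ?case .
qed simp

text \<open>
  Polynomials of degree less than \<open>2N\<close> are harmonic for the walk, because the \<open>2N\<close>-th difference
  annihilates them.  The set \<open>S\<close> may be larger than the support of the step, so that one set serves
  all starting points in an interval.
\<close>
lemma step_mass_mean_value: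
  assumes deg: "degree h < 2 * N" and S: "finite S" "{x - int N..x + int N} \<subseteq> S"
  shows "(\<Sum>y\<in>S. step_mass N c (y - x) * poly h (real_of_int y)) = poly h (real_of_int x)"
proof -
  have im: "(\<lambda>j. x - int N + int j) ` {..2 * N} = {x - int N..x + int N}"
    using image_int_atMost[of "x - int N" "2 * N"] by simp
  have "(\<Sum>y\<in>S. step_mass N c (y - x) * poly h (real_of_int y)) =
        (\<Sum>y\<in>{x - int N..x + int N}. step_mass N c (y - x) * poly h (real_of_int y))"
    using S by (intro sum.mono_neutral_right) (auto simp: step_mass_eq_0)
  also have "\<dots> = (\<Sum>y\<in>{x - int N..x + int N}. (if y = x then poly h (real_of_int y) else 0)
     - c * ((-1) powi (y - x) * binom_int (2 * N) (y - x + int N) * poly h (real_of_int y)))"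
    by (intro sum.cong refl) (simp add: step_mass_eq algebra_simps)
  also have "\<dots> = poly h (real_of_int x) - c * (\<Sum>y\<in>{x - int N..x + int N}.
       (-1) powi (y - x) * binom_int (2 * N) (y - x + int N) * poly h (real_of_int y))"
    by (simp add: sum_subtractf sum_distrib_left)
  also have "(\<Sum>y\<in>{x - int N..x + int N}.
       (-1) powi (y - x) * binom_int (2 * N) (y - x + int N) * poly h (real_of_int y)) =
      (\<Sum>j\<le>2 * N. (-1) powi (int j - int N) * real (2 * N choose j) *
         poly h (real_of_int (x - int N) + real j))"
    unfolding im[symmetric] by (subst sum.reindex) (auto simp: inj_on_def o_def)
  also have "\<dots> = (-1) ^ N * (\<Sum>j\<le>2 * N. (-1) ^ j * real (2 * N choose j) *
         poly h (real_of_int (x - int N) + real j))"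
    unfolding sum_distrib_left
    by (intro sum.cong refl) (auto simp: power_int_minus_left minus_one_power_iff)
  also have "\<dots> = 0" by (simp only: alternating_binomial_sum_poly[OF deg])
  finally show ?thesis by simp
qed

section \<open>Rational resolvents by Cramer's rule\<close>

text \<open>
  Cramer's rule for the matrix \<open>I - z Q\<close>, taken over the polynomials in \<open>z\<close>: \<open>q\<close> is its determinant and
  \<open>g\<close> a row of its adjugate.  The adjugate is an inverse up to \<open>q\<close> on both sides; from one side it
  gives the equation for \<open>g\<close>, from the other side that every solution \<open>F\<close> is \<open>g / q\<close>.
\<close>
lemma polynomial_resolvent_row:
  fixes Q :: "nat \<Rightarrow> nat \<Rightarrow> real"
  assumes inj: "\<And>z v. z \<in> {0..1} \<Longrightarrow> \<forall>i<m. v i = z * (\<Sum>j<m. Q i j * v j) \<Longrightarrow> \<forall>i<m. v i = 0"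
    and i0: "i0 < m"
  obtains q :: "real poly" and g :: "nat \<Rightarrow> real poly"
    where "\<And>z. z \<in> {0..1} \<Longrightarrow> poly q z \<noteq> 0"
      and "\<And>z j. j < m \<Longrightarrow>
        poly (g j) z - z * (\<Sum>i<m. poly (g i) z * Q i j) = (if j = i0 then poly q z else 0)"
      and "\<And>z F j. z \<in> {0..1} \<Longrightarrow> j < m \<Longrightarrow>
        \<forall>k<m. F k = (if k = i0 then 1 else 0) + z * (\<Sum>i<m. F i * Q i k) \<Longrightarrow>
        F j = poly (g j) z / poly q z"
proof -
  define M :: "real poly mat" where
    "M = mat m m (\<lambda>(i,j). (if i = j then 1 else 0) - [:0, Q i j:])"
  have M[simp]: "M \<in> carrier_mat m m" by (simp add: M_def)
  define q where "q = Determinant.det M"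
  define g where "g j = adj_mat M $$ (i0, j)" for j
  note adj = adj_mat[OF M]
  have entry: "poly (M $$ (i,j)) z = (if i = j then 1 else 0) - z * Q i j"
    if "i < m" "j < m" for i j z
    using that by (simp add: M_def)
  have adj_dim: "dim_row (adj_mat M) = m" "dim_col (adj_mat M) = m" "dim_row M = m" "dim_col M = m"
    using adj(1) M by (auto simp del: M)
  have left: "(\<Sum>i<m. adj_mat M $$ (k,i) * M $$ (i,j)) = (if k = j then q else 0)"
    if "k < m" "j < m" for k j
  proof -
    have "(adj_mat M * M) $$ (k,j) = (\<Sum>i<m. adj_mat M $$ (k,i) * M $$ (i,j))"
      using that adj_dim by (simp add: scalar_prod_def lessThan_atLeast0)
    with that show ?thesis by (cases "k = j") (auto simp: adj q_def)
  qed
  have right: "(\<Sum>i<m. M $$ (k,i) * adj_mat M $$ (i,j)) = (if k = j then q else 0)"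
    if "k < m" "j < m" for k j
  proof -
    have "(M * adj_mat M) $$ (k,j) = (\<Sum>i<m. M $$ (k,i) * adj_mat M $$ (i,j))"
      using that adj_dim by (simp add: scalar_prod_def lessThan_atLeast0)
    with that show ?thesis by (cases "k = j") (auto simp: adj q_def)
  qed
  show ?thesis
  proof
    fix z :: real assume z: "z \<in> {0..1}"
    let ?A = "map_mat (\<lambda>p. poly p z) M"
    interpret ev: comm_ring_hom "\<lambda>p. poly p z" by unfold_locales auto
    show nz: "poly q z \<noteq> 0"
    proof
      assume "poly q z = 0"
      then have "Determinant.det ?A = 0" by (simp add: q_def ev.hom_det)
      moreover have A: "?A \<in> carrier_mat m m" by simp
      ultimately obtain v where v: "v \<in> carrier_vec m" "v \<noteq> 0\<^sub>v m" "?A *\<^sub>v v = 0\<^sub>v m"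
        using det_0_iff_vec_prod_zero_field[OF A] by auto
      have "vec_index v i = z * (\<Sum>j<m. Q i j * vec_index v j)" if "i < m" for i
      proof -
        have "0 = vec_index (?A *\<^sub>v v) i" using v that by simp
        also have "\<dots> = (\<Sum>j<m. poly (M $$ (i,j)) z * vec_index v j)"
          using v(1) that adj_dim by (simp add: scalar_prod_def lessThan_atLeast0)
        also have "\<dots> = (\<Sum>j<m. (if i = j then vec_index v j else 0) - z * (Q i j * vec_index v j))"
          using that by (intro sum.cong) (auto simp: entry algebra_simps)
        also have "\<dots> = vec_index v i - z * (\<Sum>j<m. Q i j * vec_index v j)"
          using that by (simp add: sum_subtractf sum_distrib_left)
        finally show ?thesis by simp
      qed
      then have "\<forall>i<m. vec_index v i = 0" using inj[OF z, of "\<lambda>i. vec_index v i"] by blast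
      then have "v = 0\<^sub>v m" using v(1) by (intro eq_vecI) auto
      with v(2) show False by simp
    qed
    fix F :: "nat \<Rightarrow> real" and j assume j: "j < m"
      and F: "\<forall>k<m. F k = (if k = i0 then 1 else 0) + z * (\<Sum>i<m. F i * Q i k)"
    have *: "(\<Sum>k<m. F k * poly (M $$ (k,i)) z) = (if i = i0 then 1 else 0)" if "i < m" for i
    proof -
      have "(\<Sum>k<m. F k * poly (M $$ (k,i)) z) = (\<Sum>k<m. (if k = i then F k else 0) - z * (F k * Q k i))"
        using that by (intro sum.cong) (auto simp: entry algebra_simps)
      also have "\<dots> = F i - z * (\<Sum>k<m. F k * Q k i)"
        using that by (simp add: sum_subtractf sum_distrib_left)
      finally show ?thesis using F that by simp
    qed
    have "F j * poly q z = (\<Sum>k<m. F k * poly (if k = j then q else 0) z)"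
    proof -
      have "(\<Sum>k<m. F k * poly (if k = j then q else 0) z) = (\<Sum>k<m. if k = j then F k * poly q z else 0)"
        by (intro sum.cong) auto
      then show ?thesis using j by simp
    qed
    also have "\<dots> = (\<Sum>k<m. F k * poly (\<Sum>i<m. M $$ (k,i) * adj_mat M $$ (i,j)) z)"
      using j right by (intro sum.cong) auto
    also have "\<dots> = (\<Sum>k<m. \<Sum>i<m. F k * poly (M $$ (k,i)) z * poly (adj_mat M $$ (i,j)) z)"
      by (simp add: poly_sum sum_distrib_left mult.assoc)
    also have "\<dots> = (\<Sum>i<m. (\<Sum>k<m. F k * poly (M $$ (k,i)) z) * poly (adj_mat M $$ (i,j)) z)"
      by (subst sum.swap) (simp add: sum_distrib_right)
    also have "\<dots> = (\<Sum>i<m. if i = i0 then poly (g j) z else 0)"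
      by (intro sum.cong) (auto simp: * g_def)
    also have "\<dots> = poly (g j) z" using i0 by simp
    finally show "F j = poly (g j) z / poly q z" using nz by (simp add: field_simps)
  next
    fix z :: real and j assume j: "j < m"
    have "poly (g j) z - z * (\<Sum>i<m. poly (g i) z * Q i j)
        = (\<Sum>i<m. (if i = j then poly (g i) z else 0) - z * (poly (g i) z * Q i j))"
      using j by (simp add: sum_subtractf sum_distrib_left)
    also have "\<dots> = (\<Sum>i<m. poly (g i * M $$ (i,j)) z)"
      using j by (intro sum.cong) (auto simp: entry algebra_simps)
    also have "\<dots> = poly (if j = i0 then q else 0) z"
      using arg_cong[OF left[OF i0 j], of "\<lambda>p. poly p z"] by (simp add: g_def poly_sum eq_commute)
    finally show "poly (g j) z - z * (\<Sum>i<m. poly (g i) z * Q i j) = (if j = i0 then poly q z else 0)"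
      by simp
  qed
qed

text \<open>
  The same for matrices indexed by a finite set, by numbering its elements.
\<close>
lemma rational_resolvent_row:
  fixes Q :: "'a \<Rightarrow> 'a \<Rightarrow> real"
  assumes fin: "finite I" and i0: "i0 \<in> I"
    and inj: "\<And>z v. z \<in> {0..1} \<Longrightarrow> \<forall>x\<in>I. v x = z * (\<Sum>y\<in>I. Q x y * v y) \<Longrightarrow> \<forall>x\<in>I. v x = 0"
  obtains q :: "real poly" and g :: "'a \<Rightarrow> real poly"
    where "\<And>z. z \<in> {0..1} \<Longrightarrow> poly q z \<noteq> 0"
      and "\<And>z y. y \<in> I \<Longrightarrow>
        poly (g y) z - z * (\<Sum>x\<in>I. poly (g x) z * Q x y) = (if y = i0 then poly q z else 0)"
      and "\<And>z F y. z \<in> {0..1} \<Longrightarrow> y \<in> I \<Longrightarrow>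
        \<forall>x\<in>I. F x = (if x = i0 then 1 else 0) + z * (\<Sum>w\<in>I. F w * Q w x) \<Longrightarrow>
        F y = poly (g y) z / poly q z"
proof -
  define m where "m = card I"
  obtain e where e: "bij_betw e {..<m} I"
    using ex_bij_betw_nat_finite[OF fin] by (auto simp: m_def lessThan_atLeast0)
  have sum_e: "(\<Sum>i<m. \<phi> (e i)) = (\<Sum>x\<in>I. \<phi> x)" for \<phi> :: "'a \<Rightarrow> real"
    by (rule sum.reindex_bij_betw[OF e])
  define d where "d = inv_into {..<m} e"
  have d: "d x < m" "e (d x) = x" if "x \<in> I" for x
    using that bij_betw_inv_into_right[OF e that] bij_betw_inv_into[OF e]
    by (auto simp: d_def bij_betw_def)
  have e_mem: "e i \<in> I" and de: "d (e i) = i" if "i < m" for i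
    using that e by (auto simp: d_def bij_betw_def)
  have e_eq: "e i = i0 \<longleftrightarrow> i = d i0" if "i < m" for i
    using d[OF i0] de that by auto
  have inj': "\<forall>i<m. v i = 0"
    if z: "z \<in> {0..1}" and v: "\<forall>i<m. v i = z * (\<Sum>j<m. Q (e i) (e j) * v j)" for z v
  proof -
    have "(\<Sum>j<m. Q (e i) (e j) * v j) = (\<Sum>y\<in>I. Q (e i) y * v (d y))" for i
      unfolding sum_e[symmetric] by (intro sum.cong) (auto simp: de)
    note sums = this
    have "\<forall>x\<in>I. v (d x) = z * (\<Sum>y\<in>I. Q x y * v (d y))"
    proof
      fix x assume x: "x \<in> I"
      show "v (d x) = z * (\<Sum>y\<in>I. Q x y * v (d y))"
        using v[rule_format, OF d(1)[OF x]] sums[of "d x"] by (simp add: d(2)[OF x])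
    qed
    from inj[OF z this] show ?thesis using de e_mem by force
  qed
  show ?thesis
  proof (rule polynomial_resolvent_row[of m "\<lambda>i j. Q (e i) (e j)" "d i0", OF inj' d(1)[OF i0]])
    fix q :: "real poly" and g
    assume q: "\<And>z. z \<in> {0..1} \<Longrightarrow> poly q z \<noteq> 0"
      and g: "\<And>z j. j < m \<Longrightarrow> poly (g j) z - z * (\<Sum>i<m. poly (g i) z * Q (e i) (e j)) =
              (if j = d i0 then poly q z else 0)"
      and uniq: "\<And>z F j. z \<in> {0..1} \<Longrightarrow> j < m \<Longrightarrow>
        \<forall>k<m. F k = (if k = d i0 then 1 else 0) + z * (\<Sum>i<m. F i * Q (e i) (e k)) \<Longrightarrow>
        F j = poly (g j) z / poly q z"
    show ?thesis
    proof (rule that[of q "\<lambda>y. g (d y)"])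
      fix z and y assume y: "y \<in> I"
      have "(\<Sum>i<m. poly (g i) z * Q (e i) y) = (\<Sum>x\<in>I. poly (g (d x)) z * Q x y)"
        unfolding sum_e[symmetric] by (intro sum.cong) (auto simp: de)
      then show "poly (g (d y)) z - z * (\<Sum>x\<in>I. poly (g (d x)) z * Q x y) = (if y = i0 then poly q z else 0)"
        using g[OF d(1)[OF y], of z] d[OF y] e_eq[OF d(1)[OF y]] by simp
    next
      fix z F y assume z: "z \<in> {0..1::real}" and y: "y \<in> I"
        and F: "\<forall>x\<in>I. F x = (if x = i0 then 1 else 0) + z * (\<Sum>w\<in>I. F w * Q w x)"
      have "\<forall>k<m. F (e k) = (if k = d i0 then 1 else 0) + z * (\<Sum>i<m. F (e i) * Q (e i) (e k))"
      proof (intro allI impI)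
        fix k assume k: "k < m"
        show "F (e k) = (if k = d i0 then 1 else 0) + z * (\<Sum>i<m. F (e i) * Q (e i) (e k))"
          unfolding sum_e[of "\<lambda>w. F w * Q w (e k)"] e_eq[OF k, symmetric]
          by (rule F[rule_format, OF e_mem[OF k]])
      qed
      from uniq[OF z d(1)[OF y] this] show "F y = poly (g (d y)) z / poly q z"
        using d[OF y] by simp
    qed (use q in blast)
  qed
qed

section \<open>Identity theorem for real-analytic functions\<close>

lemma rational_real_analytic_on:
  assumes "\<And>x. x \<in> S \<Longrightarrow> poly q x \<noteq> 0"
  shows "real_analytic_on (\<lambda>x. poly p x / poly q x) S"
  unfolding real_analytic_on_def
proof
  fix x assume x: "x \<in> S"
  have expand: "(\<lambda>h. poly r (x + h)) has_fps_expansion fps_of_poly (pcompose r [:x, 1:])" for r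
    unfolding has_fps_expansion_def by (simp add: poly_pcompose)
  have "fps_nth (fps_of_poly (pcompose q [:x, 1:])) 0 \<noteq> 0"
    using assms[OF x] by (simp flip: poly_0_coeff_0 add: poly_pcompose)
  from has_fps_expansion_divide'[OF expand expand this]
  show "\<exists>F. (\<lambda>h. poly p (x + h) / poly q (x + h)) has_fps_expansion F" by blast
qed

text \<open>
  Isolated zeros for the difference \<open>f - g\<close>: either its power series vanishes, or its first nonzero
  coefficient dominates near \<open>x\<close>.
\<close>
lemma real_analytic_local_dichotomy:
  assumes f: "(\<lambda>h. f (x + h)) has_fps_expansion F" and g: "(\<lambda>h. g (x + h)) has_fps_expansion G"
  shows "eventually (\<lambda>y. f y = g y) (nhds x) \<or> eventually (\<lambda>y. f y \<noteq> g y) (at (x::real))"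
proof -
  have D: "(\<lambda>h. f (x + h) - g (x + h)) has_fps_expansion (F - G)"
    using f g by (rule has_fps_expansion_diff)
  then obtain e where e: "e > 0" "\<And>h. \<bar>h\<bar> < e \<Longrightarrow> eval_fps (F - G) h = f (x + h) - g (x + h)"
    by (auto simp: has_fps_expansion_def eventually_nhds_metric dist_real_def)
  have rad: "fps_conv_radius (F - G) > 0" using D by (simp add: has_fps_expansion_def)
  define r where "r = (if fps_conv_radius (F - G) = \<infinity> then e else min e (real_of_ereal (fps_conv_radius (F - G))))"
  have r: "r > 0" "r \<le> e" "ereal r \<le> fps_conv_radius (F - G)"
    using rad e(1) by (cases "fps_conv_radius (F - G)"; auto simp: r_def)+
  have sums: "(\<lambda>n. fps_nth (F - G) n * (y - x) ^ n) sums (f y - g y)" if "norm (y - x) < r" for y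
  proof -
    have "ereal (norm (y - x)) < fps_conv_radius (F - G)" using that r(3) 
      by (metis ereal_less_eq(3) ereal_less_le less_ereal.simps(1) order_less_le_trans)
    from sums_eval_fps[OF this] show ?thesis
      using e(2)[of "y - x"] that r(2) by simp
  qed
  consider "F - G = 0" | "f x \<noteq> g x" | m where "f x = g x" "fps_nth (F - G) m \<noteq> 0" "m > 0"
  proof (cases "F - G = 0 \<or> f x \<noteq> g x")
    case False
    then obtain m where m: "fps_nth (F - G) m \<noteq> 0" by (auto simp: fps_eq_iff)
    have "fps_nth (F - G) 0 = 0"
      using e(2)[of 0] e(1) False by (simp add: eval_fps_at_0)
    with m that(3)[of m] False show ?thesis by (cases m) auto
  qed (use that in blast)
  then show ?thesis
  proof cases
    case 1
    then have "\<forall>y. dist y x < e \<longrightarrow> f y = g y"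
      using e(2)[of "_ - x"] by (auto simp: dist_real_def)
    with e(1) show ?thesis unfolding eventually_nhds_metric by blast
  next
    case 2
    have "((\<lambda>y. f y - g y) \<longlongrightarrow> f x - g x) (at x)"
    proof -
      have "continuous (at 0) (\<lambda>h. f (x + h) - g (x + h))"
        by (rule has_fps_expansion_imp_continuous[OF D])
      then have "((\<lambda>h. f (x + h) - g (x + h)) \<longlongrightarrow> f x - g x) (at 0)"
        by (simp add: continuous_at)
      then show ?thesis by (subst (asm) LIM_offset_zero_iff[symmetric]) auto
    qed
    then have "eventually (\<lambda>y. f y - g y \<noteq> 0) (at x)"
      using 2 by (intro tendsto_imp_eventually_ne) auto
    then show ?thesis by (simp)
  next
    case (3 m)
    obtain s where "s > 0" "\<And>y. y \<in> cball x s - {x} \<Longrightarrow> f y - g y \<noteq> 0"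
      using powser_0_nonzero[of r x "fps_nth (F - G)" "\<lambda>y. f y - g y" m, OF r(1) sums] 3
      by (smt (verit))
    then have "\<forall>y. y \<noteq> x \<and> dist y x < s \<longrightarrow> f y \<noteq> g y" 
      by (auto simp: dist_commute)
    with \<open>s > 0\<close> show ?thesis unfolding eventually_at by blast
  qed
qed

text \<open>
  By the dichotomy the points near which the functions agree and those near which they differ (up to
  the point itself) are two disjoint open sets that cover the interval, which is connected.
\<close>
lemma real_analytic_identity:
  assumes f: "real_analytic_on f {a<..<b}" and g: "real_analytic_on g {a<..<b}"
    and r: "a < r" "\<And>x. x \<in> {a<..<r} \<Longrightarrow> f x = g x" "r \<le> b"
    and x: "x \<in> {a<..<b}"
  shows "f x = g x"
proof -
  let ?U = "{x\<in>{a<..<b}. eventually (\<lambda>y. f y = g y) (nhds x)}"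
  let ?V = "{x\<in>{a<..<b}. eventually (\<lambda>y. f y \<noteq> g y) (at x)}"
  have op: "open {x. eventually P (nhds x)}" for P :: "real \<Rightarrow> bool"
  proof (rule Topological_Spaces.openI)
    fix x assume "x \<in> {x. eventually P (nhds x)}"
    then obtain S where "open S" "x \<in> S" "\<forall>y\<in>S. P y"
      by (auto simp: eventually_nhds)
    then show "\<exists>T. open T \<and> x \<in> T \<and> T \<subseteq> {x. eventually P (nhds x)}"
      by (intro exI[of _ S]) (auto simp: eventually_nhds)
  qed
  have "open ?U"
  proof -
    have "?U = {a<..<b} \<inter> {x. eventually (\<lambda>y. f y = g y) (nhds x)}" by auto
    then show ?thesis using op by (simp add: open_Int)
  qed
  moreover have "open ?V"
  proof (rule Topological_Spaces.openI)
    fix x assume "x \<in> ?V"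
    then obtain S where S: "open S" "x \<in> S" "\<forall>y\<in>S. y \<noteq> x \<longrightarrow> f y \<noteq> g y" and xab: "x \<in> {a<..<b}"
      by (auto simp: eventually_at_topological)
    have "y \<in> ?V" if "y \<in> S \<inter> {a<..<b}" for y
    proof (cases "y = x")
      case False
      have "open (S - {x})" "y \<in> S - {x}" using S that False by (auto intro: open_delete)
      then have "eventually (\<lambda>y. f y \<noteq> g y) (nhds y)"
        using S(3) unfolding eventually_nhds by blast
      then show ?thesis using that by (auto simp: eventually_nhds_conv_at)
    qed (use \<open>x \<in> ?V\<close> in simp)
    with S(1,2) xab show "\<exists>T. open T \<and> x \<in> T \<and> T \<subseteq> ?V"
      by (intro exI[of _ "S \<inter> {a<..<b}"]) auto
  qed
  moreover have "{a<..<b} \<subseteq> ?U \<union> ?V"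
    using f g real_analytic_local_dichotomy unfolding real_analytic_on_def by fastforce
  moreover have "?U \<inter> ?V \<inter> {a<..<b} = {}"
  proof -
    have "False" if "eventually (\<lambda>y. f y = g y) (nhds x)" "eventually (\<lambda>y. f y \<noteq> g y) (at x)" for x
    proof -
      have "eventually (\<lambda>y. f y = g y) (at x)" using that(1) by (simp add: eventually_nhds_conv_at)
      with that(2) have "eventually (\<lambda>y. False) (at x)" by eventually_elim auto
      then show False by simp
    qed
    then show ?thesis by blast
  qed
  moreover have "?U \<inter> {a<..<b} \<noteq> {}"
  proof -
    have "(a + r) / 2 \<in> {a<..<r}" "open {a<..<r}" using r by auto
    then have "eventually (\<lambda>y. f y = g y) (nhds ((a + r) / 2))"
      unfolding eventually_nhds using r(2) by blast
    then have "(a + r) / 2 \<in> ?U" using r by auto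
    then show ?thesis by blast
  qed
  ultimately have "?V \<inter> {a<..<b} = {}"
    using connected_Ioo[of a b] unfolding connected_def by blast
  with \<open>{a<..<b} \<subseteq> ?U \<union> ?V\<close> x have "eventually (\<lambda>y. f y = g y) (nhds x)" by blast
  then show ?thesis by (rule eventually_nhds_x_imp_x)
qed

section \<open>Path masses of the killed walk\<close>

lemma walk_fun_upd: "j \<le> n \<Longrightarrow> walk (u(Suc n := d)) j = walk u j"
  by (auto simp: walk_def intro!: sum.cong)

lemma walk_Suc: "walk u (Suc n) = walk u n + u (Suc n)"
  by (simp add: walk_def)

lemma walk_0 [simp]: "walk u 0 = 0"
  by (simp add: walk_def)

lemma pseudo_prob_alt:
  "pseudo_prob N c n E = (\<Sum>u\<in>{1..n} \<rightarrow>\<^sub>E {- int N..int N}. if E u then \<Prod>j=1..n. step_mass N c (u j) else 0)"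
proof -
  have "finite ({1..n} \<rightarrow>\<^sub>E {- int N..int N})" by (intro finite_PiE) auto
  then show ?thesis unfolding pseudo_prob_def by (rule sum.inter_filter)
qed

text \<open>
  A path of \<open>n + 1\<close> steps is a path of \<open>n\<close> steps together with its last step, and the product
  weight factorizes accordingly.  The set \<open>I\<close> only has to contain the positions at which the last step
  can start.
\<close>
lemma pseudo_prob_last_step:
  assumes upd: "\<And>u d. E (u(Suc n := d)) \<longleftrightarrow> E u" and I: "finite I" "\<And>u. E u \<Longrightarrow> walk u n \<in> I"
  shows "pseudo_prob N c (Suc n) (\<lambda>u. E u \<and> walk u (Suc n) = y) =
    (\<Sum>x\<in>I. pseudo_prob N c n (\<lambda>u. E u \<and> walk u n = x) * step_mass N c (y - x))"
proof -
  let ?A = "{- int N..int N}" and ?w = "\<lambda>u. \<Prod>j=1..n. step_mass N c (u j)"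
  let ?P = "{1..n} \<rightarrow>\<^sub>E ?A" and ?h = "\<lambda>(d, u). u(Suc n := d)"
  have P: "finite ?P" by (intro finite_PiE) auto
  have ins: "{1..Suc n} \<rightarrow>\<^sub>E ?A = ?h ` (?A \<times> ?P)"
    using PiE_insert_eq[of "Suc n" "{1..n}" "\<lambda>_. ?A"] by (simp add: atLeastAtMostSuc_conv)
  have inj: "inj_on ?h (?A \<times> ?P)"
    using inj_combinator[of "Suc n" "{1..n}" "\<lambda>_. ?A"] by simp
  have last: "(\<Sum>d\<in>?A. if walk u n + d = y then step_mass N c d else 0) = step_mass N c (y - walk u n)"
    for u
  proof -
    have "(\<Sum>d\<in>?A. if walk u n + d = y then step_mass N c d else 0) =
          (\<Sum>d\<in>?A. if d = y - walk u n then step_mass N c d else 0)"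
      by (intro sum.cong) auto
    also have "\<dots> = step_mass N c (y - walk u n)" by (auto simp: step_mass_def)
    finally show ?thesis .
  qed
  have "pseudo_prob N c (Suc n) (\<lambda>u. E u \<and> walk u (Suc n) = y) =
    (\<Sum>(d,u)\<in>?A \<times> ?P. if E u \<and> walk u n + d = y then ?w u * step_mass N c d else 0)"
    unfolding pseudo_prob_alt ins sum.reindex[OF inj] o_def
  proof (intro sum.cong refl, clarify)
    fix d u
    have "(\<Prod>j=1..n. step_mass N c ((u(Suc n := d)) j)) = ?w u"
      by (intro prod.cong) auto
    then show "(if E (u(Suc n := d)) \<and> walk (u(Suc n := d)) (Suc n) = y
        then \<Prod>j=1..Suc n. step_mass N c ((u(Suc n := d)) j) else 0) =
      (if E u \<and> walk u n + d = y then ?w u * step_mass N c d else 0)"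
      by (simp add: upd walk_Suc walk_fun_upd)
  qed
  also have "\<dots> = (\<Sum>u\<in>?P. \<Sum>d\<in>?A. if E u \<and> walk u n + d = y then ?w u * step_mass N c d else 0)"
    by (subst sum.cartesian_product[symmetric], rule sum.swap)
  also have "\<dots> = (\<Sum>u\<in>?P. if E u then ?w u * step_mass N c (y - walk u n) else 0)"
    unfolding last[symmetric] sum_distrib_left by (intro sum.cong refl) (auto intro!: sum.cong)
  also have "\<dots> = (\<Sum>u\<in>?P. \<Sum>x\<in>I. (if E u \<and> walk u n = x then ?w u else 0) * step_mass N c (y - x))"
  proof (intro sum.cong refl)
    fix u
    show "(if E u then ?w u * step_mass N c (y - walk u n) else 0) =
      (\<Sum>x\<in>I. (if E u \<and> walk u n = x then ?w u else 0) * step_mass N c (y - x))"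
    proof (cases "E u")
      case True
      have "(\<Sum>x\<in>I. (if E u \<and> walk u n = x then ?w u else 0) * step_mass N c (y - x)) =
            (\<Sum>x\<in>I. if x = walk u n then ?w u * step_mass N c (y - x) else 0)"
        using True by (intro sum.cong) auto
      with I(1) I(2)[OF True] True show ?thesis by simp
    qed simp
  qed
  also have "\<dots> = (\<Sum>x\<in>I. pseudo_prob N c n (\<lambda>u. E u \<and> walk u n = x) * step_mass N c (y - x))"
    unfolding pseudo_prob_alt sum_distrib_right by (rule sum.swap)
  finally show ?thesis .
qed

text \<open>
  The \<open>k\<close>-step transition weights from \<open>0\<close> of the walk that is killed outside \<open>(a, b)\<close>.
\<close>
definition inside_mass :: "nat \<Rightarrow> real \<Rightarrow> int \<Rightarrow> int \<Rightarrow> nat \<Rightarrow> int \<Rightarrow> real" where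
  "inside_mass N c a b k y = 
     pseudo_prob N c k (\<lambda>u. (\<forall>j\<in>{1..k}. walk u j \<in> {a<..<b}) \<and> walk u k = y)"

lemma inside_mass_0: "inside_mass N c a b 0 y = (if y = 0 then 1 else 0)"
  by (auto simp: inside_mass_def pseudo_prob_alt)

text \<open>
  For \<open>k = 0\<close> this uses that the walk starts inside the interval, since time \<open>0\<close> does not belong to
  the event.
\<close>
lemma inside_mass_step:
  assumes "a < 0" "0 < b"
  shows "pseudo_prob N c (Suc k) (\<lambda>u. (\<forall>j\<in>{1..k}. walk u j \<in> {a<..<b}) \<and> walk u (Suc k) = y) =
    (\<Sum>x\<in>{a<..<b}. inside_mass N c a b k x * step_mass N c (y - x))"
  unfolding inside_mass_def
proof (rule pseudo_prob_last_step)
  show "walk u k \<in> {a<..<b}" if "\<forall>j\<in>{1..k}. walk u j \<in> {a<..<b}" for u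
    using that assms by (cases k) auto
qed (simp_all add: walk_fun_upd)

lemma inside_mass_Suc:
  assumes "a < 0" "0 < b" "y \<in> {a<..<b}"
  shows "inside_mass N c a b (Suc k) y = (\<Sum>x\<in>{a<..<b}. inside_mass N c a b k x * step_mass N c (y - x))"
proof -
  have "(\<forall>j\<in>{1..Suc k}. walk u j \<in> {a<..<b}) \<and> walk u (Suc k) = y \<longleftrightarrow>
        (\<forall>j\<in>{1..k}. walk u j \<in> {a<..<b}) \<and> walk u (Suc k) = y" for u
    using assms(3) by (auto simp: le_Suc_eq)
  with inside_mass_step[OF assms(1,2)] show ?thesis
    by (simp only: inside_mass_def)
qed

lemma exit_mass_Suc:
  assumes "a < 0" "0 < b" "l \<le> a \<or> b \<le> l"
  shows "exit_mass N c a b (Suc k) l = (\<Sum>x\<in>{a<..<b}. inside_mass N c a b k x * step_mass N c (l - x))"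
  using inside_mass_step[OF assms(1,2)] exit_mass_eq[OF _ assms(3), of "Suc k"]
  by (simp add: atLeastLessThanSuc_atLeastAtMost)

lemma sum_abs_step_mass_le: "finite I \<Longrightarrow> (\<Sum>y\<in>I. \<bar>step_mass N c (y - x)\<bar>) \<le> abs_mass N c"
proof -
  assume I: "finite I"
  have "(\<Sum>y\<in>I. \<bar>step_mass N c (y - x)\<bar>) = (\<Sum>k\<in>(\<lambda>y. y - x) ` I. \<bar>step_mass N c k\<bar>)"
    by (subst sum.reindex) (auto simp: inj_on_def)
  also have "\<dots> \<le> (\<Sum>k\<in>(\<lambda>y. y - x) ` I \<union> {- int N..int N}. \<bar>step_mass N c k\<bar>)"
    using I by (intro sum_mono2) auto
  also have "\<dots> = abs_mass N c"
    unfolding abs_mass_def using I by (intro sum.mono_neutral_right) (auto simp: step_mass_def)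
  finally show ?thesis .
qed

text \<open>
  A step multiplies the total absolute mass by at most \<open>M\<^sub>1\<close>; hence the path series converge for
  \<open>\<bar>z\<bar> < 1 / M\<^sub>1\<close>.
\<close>
lemma sum_abs_inside_mass_le:
  assumes "a < 0" "0 < b"
  shows "(\<Sum>y\<in>{a<..<b}. \<bar>inside_mass N c a b k y\<bar>) \<le> abs_mass N c ^ k"
proof (induction k)
  case 0
  have "(\<Sum>y\<in>{a<..<b}. \<bar>inside_mass N c a b 0 y\<bar>) = (\<Sum>y\<in>{a<..<b}. if y = 0 then 1 else 0)"
    by (intro sum.cong) (auto simp: inside_mass_0)
  then show ?case using assms by simp
next
  case (Suc k)
  let ?I = "{a<..<b}"
  have "(\<Sum>y\<in>?I. \<bar>inside_mass N c a b (Suc k) y\<bar>) \<le>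
        (\<Sum>y\<in>?I. \<Sum>x\<in>?I. \<bar>inside_mass N c a b k x\<bar> * \<bar>step_mass N c (y - x)\<bar>)"
    by (intro sum_mono) (auto simp: inside_mass_Suc[OF assms] abs_mult[symmetric])
  also have "\<dots> = (\<Sum>x\<in>?I. \<bar>inside_mass N c a b k x\<bar> * (\<Sum>y\<in>?I. \<bar>step_mass N c (y - x)\<bar>))"
    by (subst sum.swap) (simp add: sum_distrib_left)
  also have "\<dots> \<le> (\<Sum>x\<in>?I. \<bar>inside_mass N c a b k x\<bar> * abs_mass N c)"
    by (intro sum_mono mult_left_mono sum_abs_step_mass_le) auto
  also have "\<dots> = abs_mass N c * (\<Sum>x\<in>?I. \<bar>inside_mass N c a b k x\<bar>)"
    by (simp add: sum_distrib_left mult.commute)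
  also have "\<dots> \<le> abs_mass N c * abs_mass N c ^ k"
    using Suc by (intro mult_left_mono) (auto simp: abs_mass_def sum_nonneg)
  finally show ?case by simp
qed

text \<open>
  The weights sum to one since constants are harmonic.  So \<open>1 / M\<^sub>1 \<le> 1\<close>, which
  matters twice: the series and the rational function are compared inside
  \<open>[0, 1]\<close>, and analytic continuation starts from a subinterval of \<open>(0, 1)\<close>.
\<close>
lemma abs_mass_ge_1:
  assumes "1 \<le> N"
  shows "1 \<le> abs_mass N c"
proof -
  have "1 = (\<Sum>k\<in>{- int N..int N}. step_mass N c k)"
    using step_mass_mean_value[of 1 N "{- int N..int N}" 0 c] assms by simp
  also have "\<dots> \<le> abs_mass N c" unfolding abs_mass_def by (intro sum_mono) auto
  finally show ?thesis .
qed

text \<open>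
  The Green function \<open>F\<close> of the killed walk is the row at \<open>0\<close> of \<open>(I - z Q)\<^sup>-\<^sup>1\<close>: the equation is the
  Neumann series, summed after splitting off the last step.
\<close>
lemma green_series:
  assumes "a < 0" "0 < b" and z: "\<bar>z\<bar> * abs_mass N c < 1"
  defines "F \<equiv> \<lambda>y. \<Sum>k. inside_mass N c a b k y * z ^ k"
  shows "y \<in> {a<..<b} \<Longrightarrow> (\<lambda>k. inside_mass N c a b k y * z ^ k) sums F y"
    and "y \<in> {a<..<b} \<Longrightarrow>
      F y = (if y = 0 then 1 else 0) + z * (\<Sum>x\<in>{a<..<b}. F x * step_mass N c (y - x))"
proof -
  let ?f = "\<lambda>y k. inside_mass N c a b k y * z ^ k"
  have sums: "?f y sums F y" if y: "y \<in> {a<..<b}" for y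
  proof -
    have bound: "\<bar>?f y k\<bar> \<le> (\<bar>z\<bar> * abs_mass N c) ^ k" for k
    proof -
      have "\<bar>inside_mass N c a b k y\<bar> \<le> (\<Sum>y\<in>{a<..<b}. \<bar>inside_mass N c a b k y\<bar>)"
        using y by (intro member_le_sum) auto
      also note sum_abs_inside_mass_le[OF assms(1,2)]
      finally have "\<bar>inside_mass N c a b k y\<bar> * \<bar>z\<bar> ^ k \<le> abs_mass N c ^ k * \<bar>z\<bar> ^ k"
        by (intro mult_right_mono) auto
      then show ?thesis
        by (simp add: abs_mult power_abs power_mult_distrib mult.commute)
    qed
    have geo: "summable (\<lambda>k. (\<bar>z\<bar> * abs_mass N c) ^ k)"
      using z by (intro summable_geometric) (auto simp: abs_mult abs_mass_def sum_nonneg)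
    have "summable (?f y)"
      by (rule summable_comparison_test'[OF geo, of 0]) (simp only: real_norm_def bound)
    then show ?thesis unfolding F_def by (rule summable_sums)
  qed
  then show "y \<in> {a<..<b} \<Longrightarrow> ?f y sums F y" .
  assume y: "y \<in> {a<..<b}"
  have "(\<lambda>k. z * (\<Sum>x\<in>{a<..<b}. ?f x k * step_mass N c (y - x))) sums
        (z * (\<Sum>x\<in>{a<..<b}. F x * step_mass N c (y - x)))"
    by (intro sums_mult sums_sum sums_mult2 sums)
  moreover have "z * (\<Sum>x\<in>{a<..<b}. ?f x k * step_mass N c (y - x)) = ?f y (Suc k)" for k
    by (simp add: inside_mass_Suc[OF assms(1,2) y] sum_distrib_left sum_distrib_right algebra_simps)
  ultimately have "(\<lambda>k. ?f y (Suc k)) sums (z * (\<Sum>x\<in>{a<..<b}. F x * step_mass N c (y - x)))"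
    by simp
  then have "?f y sums (z * (\<Sum>x\<in>{a<..<b}. F x * step_mass N c (y - x)) + ?f y 0)"
    by (rule sums_Suc)
  from sums_unique2[OF sums[OF y] this]
  show "F y = (if y = 0 then 1 else 0) + z * (\<Sum>x\<in>{a<..<b}. F x * step_mass N c (y - x))"
    by (simp add: inside_mass_0)
qed

section \<open>Analytic continuation of the exit generating functions\<close>

lemma has_exit_prob_unique:
  assumes N: "1 \<le> N" and p: "has_exit_prob N c a b l p" and q: "has_exit_prob N c a b l q"
  shows "p = q"
proof -
  obtain G H where G: "is_exit_gf N c a b l G" "(G \<longlongrightarrow> p) (at_left 1)"
    and H: "is_exit_gf N c a b l H" "(H \<longlongrightarrow> q) (at_left 1)"
    using p q by (auto simp: has_exit_prob_def)
  have r: "0 < 1 / abs_mass N c" "1 / abs_mass N c \<le> 1" using abs_mass_ge_1[OF N, of c] by auto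
  have "G z = H z" if "z \<in> {0<..<1 / abs_mass N c}" for z
    using G(1) H(1) that unfolding is_exit_gf_def by (blast intro: sums_unique2)
  then have "G z = H z" if "z \<in> {0<..<1}" for z
    using real_analytic_identity[of G 0 1 H "1 / abs_mass N c" z] G(1) H(1) r that
    by (auto simp: is_exit_gf_def)
  then have "eventually (\<lambda>z. G z = H z) (at_left 1)"
    unfolding eventually_at_left_field by (intro exI[of _ 0]) auto
  then have "(H \<longlongrightarrow> p) (at_left 1)"
    using G(2) by (simp add: tendsto_cong)
  with H(2) show ?thesis using tendsto_unique trivial_limit_at_left_real by blast
qed

text \<open>
  With \<open>G\<^sub>x(z) = g\<^sub>x(z) / q(z)\<close> the rational Green function, the generating
  function of the exits at \<open>l\<close> is \<open>z \<Sum>\<^sub>x G\<^sub>x(z) p\<^sub>l\<^sub>-\<^sub>x\<close>, which has no pole on \<open>[0, 1]\<close>; thus \<open>P\<close> is its value at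
  \<open>1\<close>.  The second claim is optional stopping: a polynomial \<open>h\<close> of degree less than \<open>2N\<close> is harmonic,
  so \<open>\<Sum>\<^sub>l p\<^sub>l\<^sub>-\<^sub>x h(l)\<close> over the exit set equals \<open>((I - Q) h)(x)\<close>, and pairing this with \<open>G(1)\<close>, the
  row at \<open>0\<close> of the inverse of \<open>I - Q\<close>, leaves \<open>h(0)\<close>.
\<close>
lemma exit_prob_exists:
  assumes N: "1 \<le> N" and c: "0 < c" and a: "a < 0" and b: "0 < b"
  obtains P where "\<And>l. l \<le> a \<or> b \<le> l \<Longrightarrow> has_exit_prob N c a b l (P l)"
    and "\<And>h. degree h < 2 * N \<Longrightarrow> (\<Sum>l\<in>exit_set N a b. P l * poly h (real_of_int l)) = poly h 0"
proof -
  let ?I = "{a<..<b}" and ?Q = "\<lambda>x y. step_mass N c (y - x)"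
  have "0 \<in> ?I" using a b by simp
  show ?thesis
  proof (rule rational_resolvent_row[of ?I 0 ?Q, OF _ \<open>0 \<in> ?I\<close>])
    show "finite ?I" by simp
    show "\<forall>x\<in>?I. v x = 0" if "z \<in> {0..1}" "\<forall>x\<in>?I. v x = z * (\<Sum>y\<in>?I. ?Q x y * v y)" for z v
      by (rule killed_walk_resolvent_injective[OF _ c that]) simp
  next
    fix q :: "real poly" and g :: "int \<Rightarrow> real poly"
    assume q: "\<And>z. z \<in> {0..1} \<Longrightarrow> poly q z \<noteq> 0"
      and g: "\<And>z y. y \<in> ?I \<Longrightarrow>
        poly (g y) z - z * (\<Sum>x\<in>?I. poly (g x) z * ?Q x y) = (if y = 0 then poly q z else 0)"
      and green: "\<And>z F y. z \<in> {0..1} \<Longrightarrow> y \<in> ?I \<Longrightarrow>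
        \<forall>x\<in>?I. F x = (if x = 0 then 1 else 0) + z * (\<Sum>w\<in>?I. F w * ?Q w x) \<Longrightarrow>
        F y = poly (g y) z / poly q z"
    define r where "r l = [:0, 1:] * (\<Sum>x\<in>?I. Polynomial.smult (step_mass N c (l - x)) (g x))" for l
    define H where "H l z = poly (r l) z / poly q z" for l z
    define P where "P l = H l 1" for l
    have H: "H l z = z * (\<Sum>x\<in>?I. poly (g x) z / poly q z * step_mass N c (l - x))" for l z
      by (simp add: H_def r_def poly_sum mult.commute flip: sum_divide_distrib)
    show ?thesis
    proof (rule that[of P])
      fix l :: int assume l: "l \<le> a \<or> b \<le> l"
      have "is_exit_gf N c a b l (H l)"
        unfolding is_exit_gf_def
      proof (intro conjI ballI)
        show "real_analytic_on (H l) {0<..<1}"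
          unfolding H_def using q by (intro rational_real_analytic_on) auto
      next
        fix z assume z: "z \<in> {0<..<1 / abs_mass N c}"
        have M: "1 \<le> abs_mass N c" by (rule abs_mass_ge_1[OF N])
        then have zM: "\<bar>z\<bar> * abs_mass N c < 1" using z by (simp add: field_simps)
        have "1 / abs_mass N c \<le> 1" using M by simp
        then have z1: "z \<in> {0..1}" using z by auto
        note ser = green_series[OF a b zM]
        let ?F = "\<lambda>y. \<Sum>k. inside_mass N c a b k y * z ^ k"
        have F: "?F y = poly (g y) z / poly q z" if "y \<in> ?I" for y
          using green[OF z1 that, of ?F] ser(2) by blast
        have "(\<lambda>k. z * (\<Sum>x\<in>?I. inside_mass N c a b k x * z ^ k * step_mass N c (l - x))) sums
              (z * (\<Sum>x\<in>?I. ?F x * step_mass N c (l - x)))"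
          by (intro sums_mult sums_sum sums_mult2 ser(1))
        moreover have "z * (\<Sum>x\<in>?I. inside_mass N c a b k x * z ^ k * step_mass N c (l - x)) =
            exit_mass N c a b (Suc k) l * z ^ Suc k" for k
          by (simp add: exit_mass_Suc[OF a b l] sum_distrib_left sum_distrib_right algebra_simps)
        ultimately show "(\<lambda>k. exit_mass N c a b (Suc k) l * z ^ Suc k) sums H l z"
          by (simp add: H F)
      qed
      moreover have "(H l \<longlongrightarrow> P l) (at_left 1)"
        unfolding P_def H_def using q[of 1] by (intro tendsto_intros) auto
      ultimately show "has_exit_prob N c a b l (P l)"
        unfolding has_exit_prob_def by blast
    next
      fix h :: "real poly" assume h: "degree h < 2 * N"
      define G where "G x = poly (g x) 1 / poly q 1" for x
      let ?h = "\<lambda>x. poly h (real_of_int x)"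
      have G: "G y - (\<Sum>x\<in>?I. G x * ?Q x y) = (if y = 0 then 1 else 0)" if "y \<in> ?I" for y
      proof -
        have "G y - (\<Sum>x\<in>?I. G x * ?Q x y) =
              (poly (g y) 1 - 1 * (\<Sum>x\<in>?I. poly (g x) 1 * ?Q x y)) / poly q 1"
          by (simp add: G_def diff_divide_distrib sum_divide_distrib)
        then show ?thesis using g[OF that, of 1] q[of 1] by simp
      qed
      have disj: "?I \<inter> exit_set N a b = {}" using a b by (auto simp: exit_set_def)
      have mean: "(\<Sum>l\<in>exit_set N a b. ?Q x l * ?h l) = ?h x - (\<Sum>y\<in>?I. ?Q x y * ?h y)" if "x \<in> ?I" for x
      proof -
        have "{x - int N..x + int N} \<subseteq> ?I \<union> exit_set N a b"
          using that by (auto simp: exit_set_def)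
        from step_mass_mean_value[OF h _ this, of c] disj show ?thesis
          by (simp add: sum.union_disjoint exit_set_def)
      qed
      have "(\<Sum>l\<in>exit_set N a b. P l * ?h l) = (\<Sum>l\<in>exit_set N a b. \<Sum>x\<in>?I. G x * (?Q x l * ?h l))"
        by (simp add: P_def H G_def sum_distrib_right mult.assoc)
      also have "\<dots> = (\<Sum>x\<in>?I. G x * (\<Sum>l\<in>exit_set N a b. ?Q x l * ?h l))"
        by (subst sum.swap) (simp add: sum_distrib_left)
      also have "\<dots> = (\<Sum>x\<in>?I. G x * ?h x) - (\<Sum>x\<in>?I. \<Sum>y\<in>?I. G x * ?Q x y * ?h y)"
        by (simp add: mean right_diff_distrib sum_subtractf sum_distrib_left mult.assoc)
      also have "(\<Sum>x\<in>?I. \<Sum>y\<in>?I. G x * ?Q x y * ?h y) = (\<Sum>y\<in>?I. (\<Sum>x\<in>?I. G x * ?Q x y) * ?h y)"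
        by (subst sum.swap) (simp add: sum_distrib_right)
      also have "(\<Sum>x\<in>?I. G x * ?h x) - \<dots> = (\<Sum>y\<in>?I. (G y - (\<Sum>x\<in>?I. G x * ?Q x y)) * ?h y)"
        by (simp add: sum_subtractf left_diff_distrib)
      also have "\<dots> = (\<Sum>y\<in>?I. if y = 0 then ?h y else 0)"
        by (intro sum.cong) (auto simp: G)
      also have "\<dots> = poly h 0" using a b by simp
      finally show "(\<Sum>l\<in>exit_set N a b. P l * ?h l) = poly h 0" .
    qed
  qed
qed

section \<open>Lagrange interpolation on two blocks of nodes\<close>

text \<open>
  Evaluation at \<open>0\<close> on polynomials of degree less than \<open>card S\<close> determines the weights at the nodes
  \<open>S\<close>: test it on the Lagrange basis polynomial of the node \<open>l\<close>.
\<close>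
lemma lagrange_functional_unique:
  fixes P :: "int \<Rightarrow> real"
  assumes S: "finite S" "l \<in> S"
    and P: "\<And>h. degree h < card S \<Longrightarrow> (\<Sum>e\<in>S. P e * poly h (real_of_int e)) = poly h 0"
  shows "P l = (\<Prod>e\<in>S - {l}. real_of_int e / real_of_int (e - l))"
proof -
  define h where "h = (\<Prod>e\<in>S - {l}. Polynomial.smult (1 / real_of_int (e - l)) [:real_of_int e, -1:])"
  have val: "poly h x = (\<Prod>e\<in>S - {l}. (real_of_int e - x) / real_of_int (e - l))" for x
    by (simp add: h_def poly_prod diff_divide_distrib)
  have "degree h \<le> (\<Sum>e\<in>S - {l}. degree (Polynomial.smult (1 / real_of_int (e - l)) [:real_of_int e, -1:]))"
    unfolding h_def using S(1) by (intro degree_prod_sum_le[unfolded o_def]) auto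
  also have "\<dots> \<le> (\<Sum>e\<in>S - {l}. 1)" by (intro sum_mono) (auto simp: degree_smult_eq)
  also have "\<dots> < card S" using S card_gt_0_iff[of S] by (auto simp: card_Diff_singleton)
  finally have deg: "degree h < card S" .
  have hl: "poly h (real_of_int l) = 1" unfolding val by (intro prod.neutral) auto
  have he: "poly h (real_of_int e) = 0" if "e \<in> S - {l}" for e
    unfolding val using that S(1) by (intro prod_zero) auto
  have "poly h 0 = (\<Sum>e\<in>S. P e * poly h (real_of_int e))" using P[OF deg] by simp
  also have "\<dots> = P l"
    using he by (subst sum.remove[OF S]) (simp add: hl)
  finally show ?thesis by (simp add: val)
qed

lemma choose_rising_prod:
  assumes "0 < x"
  shows "real (nat (x + int N - 1) choose N) = (\<Prod>j<N. real_of_int (x + int j)) / fact N"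
proof -
  have "real (nat (x + int N - 1)) - real N + 1 = real_of_int x" using assms by simp
  then have "real (nat (x + int N - 1) choose N) = pochhammer (real_of_int x) N / fact N"
    unfolding binomial_gbinomial gbinomial_pochhammer' by simp
  then show ?thesis by (simp add: pochhammer_prod lessThan_atLeast0)
qed

lemma prod_diff_all_others:
  assumes "l < N"
  shows "(\<Prod>j\<in>{..<N} - {l}. real_of_int (int j - int l)) = (-1) ^ l * fact l * fact (N - 1 - l)"
proof -
  have up: "{l<..<N} = (\<lambda>i. Suc l + i) ` {0..<N - 1 - l}"
    using assms by (subst image_add_atLeastLessThan) auto
  have "{..<N} - {l} = {0..<l} \<union> {l<..<N}" using assms by auto
  moreover have ivl_disj: "{0..<l} \<inter> {l<..<N} = {}" by auto
  ultimately have "(\<Prod>j\<in>{..<N} - {l}. real_of_int (int j - int l)) =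
      (\<Prod>j\<in>{0..<l}. real_of_int (int j - int l)) * (\<Prod>j\<in>{l<..<N}. real_of_int (int j - int l))"
    by (simp only: prod.union_disjoint[OF finite_atLeastLessThan finite_greaterThanLessThan ivl_disj])
  also have "(\<Prod>j\<in>{0..<l}. real_of_int (int j - int l)) = pochhammer (- real l) l"
    unfolding pochhammer_prod by (intro prod.cong) auto
  also have "\<dots> = (-1) ^ l * fact l" by (rule pochhammer_same)
  also have "(\<Prod>j\<in>{l<..<N}. real_of_int (int j - int l)) = pochhammer 1 (N - 1 - l)"
    unfolding up pochhammer_prod by (subst prod.reindex) (auto simp: algebra_simps)
  also have "\<dots> = fact (N - 1 - l)" by (simp add: pochhammer_fact)
  finally show ?thesis by simp
qed

text \<open>
  The Lagrange weight of a node when the nodes are two blocks of \<open>N\<close> consecutive integers on either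
  side of \<open>0\<close>, starting at distances \<open>x\<close> and \<open>y\<close>.  The first product runs over the block of the node, the second
  over the other block.
\<close>
lemma lagrange_weight:
  fixes x y :: int
  assumes l: "l < N" and x: "0 < x" and y: "0 < y"
  shows "(\<Prod>j\<in>{..<N} - {l}. real_of_int (x + int j) / real_of_int (int j - int l)) *
         (\<Prod>j<N. real_of_int (y + int j) / real_of_int (y + int j + (x + int l))) =
     (-1) ^ l * (real (nat (x + int N - 1) choose N) * real (nat (y + int N - 1) choose N) * real N
            / real_of_int (int l + x)) * real ((N - 1) choose l)
            / real (nat (int l + x + y + int N - 1) choose N)"
proof -
  define X Y Z where "X = real (nat (x + int N - 1) choose N)"
    and "Y = real (nat (y + int N - 1) choose N)"
    and "Z = real (nat (int l + x + y + int N - 1) choose N)"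
  have Xp: "(\<Prod>j<N. real_of_int (x + int j)) = fact N * X"
    using choose_rising_prod[OF x, of N] by (simp add: X_def)
  have Yp: "(\<Prod>j<N. real_of_int (y + int j)) = fact N * Y"
    using choose_rising_prod[OF y, of N] by (simp add: Y_def)
  have Zp: "(\<Prod>j<N. real_of_int (y + int j + (x + int l))) = fact N * Z"
    using choose_rising_prod[of "int l + x + y" N] x y by (simp add: Z_def algebra_simps)
  have Z0: "Z \<noteq> 0" using x y by (simp add: Z_def)
  have "(\<Prod>j<N. real_of_int (x + int j)) = real_of_int (int l + x) * (\<Prod>j\<in>{..<N} - {l}. real_of_int (x + int j))"
    using l by (subst prod.remove[of _ l]) (auto simp: add.commute)
  then have X': "(\<Prod>j\<in>{..<N} - {l}. real_of_int (x + int j)) = fact N * X / real_of_int (int l + x)"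
    using Xp x by (simp add: field_simps)
  have fct: "fact N = (real N * real ((N - 1) choose l)) * (fact l * fact (N - 1 - l))"
    using l binomial_fact[of l "N - 1", where 'a = real] fact_reduce[of N, where 'a = real] by simp
  have "(\<Prod>j\<in>{..<N} - {l}. real_of_int (x + int j) / real_of_int (int j - int l)) *
         (\<Prod>j<N. real_of_int (y + int j) / real_of_int (y + int j + (x + int l))) =
    (fact N * X / real_of_int (int l + x)) / ((-1) ^ l * fact l * fact (N - 1 - l)) * (fact N * Y / (fact N * Z))"
    by (simp only: prod_dividef X' prod_diff_all_others[OF l] Yp Zp)
  also have "\<dots> = fact N / ((-1) ^ l * fact l * fact (N - 1 - l)) * (X / real_of_int (int l + x)) * (Y / Z)"
    by simp
  also have "fact N / ((-1) ^ l * fact l * fact (N - 1 - l)) = (-1) ^ l * (real N * real ((N - 1) choose l))"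
    unfolding fct by (simp add: minus_one_power_iff)
  also have "\<dots> * (X / real_of_int (int l + x)) * (Y / Z) =
      (-1) ^ l * (X * Y * real N / real_of_int (int l + x)) * real ((N - 1) choose l) / Z"
    by simp
  finally show ?thesis by (simp add: X_def Y_def Z_def)
qed

section \<open>The exit distribution\<close>

lemma exit_prob_eq:
  assumes N: "1 \<le> N" and p: "has_exit_prob N c a b l p"
  shows "exit_prob N c a b l = p"
  unfolding exit_prob_def using p has_exit_prob_unique[OF N] by blast

lemma upper_block: "{b..b + int N - 1} = (\<lambda>j. b + int j) ` {..<N}"
proof -
  have "x \<in> (\<lambda>j. b + int j) ` {..<N}" if "b \<le> x" "x \<le> b + int N - 1" for x
    using that by (intro image_eqI[of _ _ "nat (x - b)"]) auto
  then show ?thesis by auto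
qed

lemma lower_block: "{a - int N + 1..a} = (\<lambda>j. a - int j) ` {..<N}"
proof -
  have "x \<in> (\<lambda>j. a - int j) ` {..<N}" if "a - int N + 1 \<le> x" "x \<le> a" for x
    using that by (intro image_eqI[of _ _ "nat (a - x)"]) auto
  then show ?thesis by auto
qed

lemma exit_set_image:
  "exit_set N a b = (\<lambda>j. a - int j) ` {..<N} \<union> (\<lambda>j. b + int j) ` {..<N}"
  unfolding exit_set_def upper_block lower_block ..

lemma card_exit_set:
  assumes "a < b"
  shows "card (exit_set N a b) = 2 * N"
  using assms unfolding exit_set_def by (subst card_Un_disjoint) auto

lemma prod_exit_set_remove_lower:
  fixes f :: "int \<Rightarrow> real"
  assumes "a < b" "l < N"
  shows "(\<Prod>e\<in>exit_set N a b - {a - int l}. f e) =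
    (\<Prod>j\<in>{..<N} - {l}. f (a - int j)) * (\<Prod>j<N. f (b + int j))"
proof -
  have "exit_set N a b - {a - int l} = (\<lambda>j. a - int j) ` ({..<N} - {l}) \<union> (\<lambda>j. b + int j) ` {..<N}"
    using assms by (auto simp: exit_set_image)
  moreover have "(\<lambda>j. a - int j) ` ({..<N} - {l}) \<inter> (\<lambda>j. b + int j) ` {..<N} = {}"
    using assms by auto
  ultimately have "(\<Prod>e\<in>exit_set N a b - {a - int l}. f e) =
      (\<Prod>e\<in>(\<lambda>j. a - int j) ` ({..<N} - {l}). f e) * (\<Prod>e\<in>(\<lambda>j. b + int j) ` {..<N}. f e)"
    by (simp add: prod.union_disjoint)
  then show ?thesis by (simp add: prod.reindex inj_on_def)
qed

lemma prod_exit_set_remove_upper: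
  fixes f :: "int \<Rightarrow> real"
  assumes "a < b" "l < N"
  shows "(\<Prod>e\<in>exit_set N a b - {b + int l}. f e) =
    (\<Prod>j\<in>{..<N} - {l}. f (b + int j)) * (\<Prod>j<N. f (a - int j))"
proof -
  have "exit_set N a b - {b + int l} = (\<lambda>j. b + int j) ` ({..<N} - {l}) \<union> (\<lambda>j. a - int j) ` {..<N}"
    using assms by (auto simp: exit_set_image)
  moreover have "(\<lambda>j. b + int j) ` ({..<N} - {l}) \<inter> (\<lambda>j. a - int j) ` {..<N} = {}"
    using assms by auto
  ultimately have "(\<Prod>e\<in>exit_set N a b - {b + int l}. f e) =
      (\<Prod>e\<in>(\<lambda>j. b + int j) ` ({..<N} - {l}). f e) * (\<Prod>e\<in>(\<lambda>j. a - int j) ` {..<N}. f e)"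
    by (simp add: prod.union_disjoint)
  then show ?thesis by (simp add: prod.reindex inj_on_def)
qed

lemma exit_const_rising:
  assumes "a < 0" "0 < b"
  shows "exit_const N a b = (-1) ^ N / (fact N)\<^sup>2 * (\<Prod>j<N. real_of_int (a - int j)) * (\<Prod>j<N. real_of_int (b + int j))"
proof -
  have "(\<Prod>j<N. real_of_int (- a + int j)) = (\<Prod>j<N. (-1) * real_of_int (a - int j))"
    by (intro prod.cong) auto
  also have "\<dots> = (-1) ^ N * (\<Prod>j<N. real_of_int (a - int j))"
    by (simp only: prod.distrib prod_constant card_lessThan)
  finally have A: "real (nat (- a + int N - 1) choose N) = (-1) ^ N * (\<Prod>j<N. real_of_int (a - int j)) / fact N"
    using choose_rising_prod[of "- a" N] assms by simp
  have e: "int N - a - 1 = - a + int N - 1" "int N + b - 1 = b + int N - 1" by simp_all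
  show ?thesis
    unfolding exit_const_def e A choose_rising_prod[OF assms(2)] by (simp add: power2_eq_square)
qed

lemma exit_prob_interpolation:
  assumes "1 \<le> N" "0 < c" "a < 0" "0 < b" "degree h < 2 * N"
  shows "(\<Sum>l\<in>exit_set N a b. exit_prob N c a b l * poly h (real_of_int l)) = poly h 0"
proof -
  obtain P where P: "\<And>l. l \<le> a \<or> b \<le> l \<Longrightarrow> has_exit_prob N c a b l (P l)"
    and interp: "\<And>h. degree h < 2 * N \<Longrightarrow> (\<Sum>l\<in>exit_set N a b. P l * poly h (real_of_int l)) = poly h 0"
    using exit_prob_exists[OF assms(1-4)] by blast
  have "exit_prob N c a b l = P l" if "l \<in> exit_set N a b" for l
    using that by (intro exit_prob_eq[OF assms(1)] P) (auto simp: exit_set_def)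
  with interp[OF assms(5)] show ?thesis by (simp cong: sum.cong)
qed

text \<open>
  The exit set has exactly \<open>2N\<close> points, as many as the dimension of the space of harmonic polynomials
  at hand, so optional stopping determines every exit probability.
\<close>
lemma exit_prob_lagrange:
  assumes "1 \<le> N" "0 < c" "a < 0" "0 < b" "l \<in> exit_set N a b"
  shows "exit_prob N c a b l = (\<Prod>e\<in>exit_set N a b - {l}. real_of_int e / real_of_int (e - l))"
proof (rule lagrange_functional_unique[OF _ assms(5)])
  show "finite (exit_set N a b)" by (simp add: exit_set_def)
  show "(\<Sum>e\<in>exit_set N a b. exit_prob N c a b e * poly h (real_of_int e)) = poly h 0"
    if "degree h < card (exit_set N a b)" for h
    using that card_exit_set[of a b N] assms by (intro exit_prob_interpolation) auto
qed

lemma exit_prob_lower: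
  assumes "1 \<le> N" "0 < c" "a < 0" "0 < b" "l < N"
  shows "exit_prob N c a b (a - int l) =
          (-1) ^ l * (exit_const N a b * real N / real_of_int (int l - a)) * real ((N - 1) choose l)
            / real (nat (int l + b - a + int N - 1) choose N)"
proof -
  have ab: "a < b" using assms by simp
  have mem: "a - int l \<in> exit_set N a b" using assms(5) by (simp add: exit_set_image)
  have A: "(\<Prod>j\<in>{..<N} - {l}. real_of_int (a - int j) / real_of_int (a - int j - (a - int l))) =
        (\<Prod>j\<in>{..<N} - {l}. real_of_int (- a + int j) / real_of_int (int j - int l))"
    by (intro prod.cong refl) (simp add: divide_simps algebra_simps)
  have B: "(\<Prod>j<N. real_of_int (b + int j) / real_of_int (b + int j - (a - int l))) =
        (\<Prod>j<N. real_of_int (b + int j) / real_of_int (b + int j + (- a + int l)))"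
    by (simp add: algebra_simps)
  have e: "int N - a - 1 = - a + int N - 1" "int N + b - 1 = b + int N - 1"
    "int l - a = int l + - a" "int l + b - a + int N - 1 = int l + - a + b + int N - 1" by simp_all
  have "exit_prob N c a b (a - int l) =
      (\<Prod>j\<in>{..<N} - {l}. real_of_int (- a + int j) / real_of_int (int j - int l)) *
      (\<Prod>j<N. real_of_int (b + int j) / real_of_int (b + int j + (- a + int l)))"
    unfolding exit_prob_lagrange[OF assms(1-4) mem] prod_exit_set_remove_lower[OF ab assms(5)] A B ..
  also have "\<dots> = (-1) ^ l * (exit_const N a b * real N / real_of_int (int l - a)) * real ((N - 1) choose l)
            / real (nat (int l + b - a + int N - 1) choose N)"
    unfolding exit_const_def e by (rule lagrange_weight) (use assms in auto)
  finally show ?thesis .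
qed

lemma exit_prob_upper:
  assumes "1 \<le> N" "0 < c" "a < 0" "0 < b" "l < N"
  shows "exit_prob N c a b (b + int l) =
          (-1) ^ l * (exit_const N a b * real N / real_of_int (int l + b)) * real ((N - 1) choose l)
            / real (nat (int l + b - a + int N - 1) choose N)"
proof -
  have ab: "a < b" using assms by simp
  have mem: "b + int l \<in> exit_set N a b" using assms(5) by (simp add: exit_set_image)
  have A: "(\<Prod>j\<in>{..<N} - {l}. real_of_int (b + int j) / real_of_int (b + int j - (b + int l))) =
        (\<Prod>j\<in>{..<N} - {l}. real_of_int (b + int j) / real_of_int (int j - int l))"
    by (intro prod.cong refl) simp
  have B: "(\<Prod>j<N. real_of_int (a - int j) / real_of_int (a - int j - (b + int l))) =
        (\<Prod>j<N. real_of_int (- a + int j) / real_of_int (- a + int j + (b + int l)))"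
    using assms by (intro prod.cong refl) (simp add: divide_simps algebra_simps)
  have e: "int N - a - 1 = - a + int N - 1" "int N + b - 1 = b + int N - 1"
    "int l + b - a + int N - 1 = int l + b + - a + int N - 1" by simp_all
  have "exit_prob N c a b (b + int l) =
      (\<Prod>j\<in>{..<N} - {l}. real_of_int (b + int j) / real_of_int (int j - int l)) *
      (\<Prod>j<N. real_of_int (- a + int j) / real_of_int (- a + int j + (b + int l)))"
    unfolding exit_prob_lagrange[OF assms(1-4) mem] prod_exit_set_remove_upper[OF ab assms(5)] A B ..
  also have "\<dots> = (-1) ^ l * (real (nat (b + int N - 1) choose N) * real (nat (- a + int N - 1) choose N) * real N
            / real_of_int (int l + b)) * real ((N - 1) choose l)
            / real (nat (int l + b + - a + int N - 1) choose N)"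
    by (rule lagrange_weight) (use assms in auto)
  finally show ?thesis
    unfolding exit_const_def e by (simp only: mult.commute[of "real (nat (b + int N - 1) choose N)"])
qed

section \<open>Beta integrals over triangles\<close>

lemma set_integral_FTC:
  fixes f F :: "real \<Rightarrow> real"
  assumes "a \<le> b" "\<And>x. (F has_real_derivative f x) (at x)" "continuous_on UNIV f"
  shows "(LINT x:{a..b}|lborel. f x) = F b - F a"
  unfolding set_lebesgue_integral_def
  using assms
  by (intro integral_FTC_atLeastAtMost)
     (auto intro: has_field_derivative_at_within continuous_on_subset
       simp flip: has_real_derivative_iff_has_vector_derivative)

lemma set_integrable_continuous_Icc:
  "continuous_on UNIV f \<Longrightarrow> set_integrable lborel {a..b} (f :: real \<Rightarrow> real)"
  by (rule borel_integrable_atLeastAtMost') (rule continuous_on_subset, auto)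

text \<open>
  Integrating the derivative of \<open>x\<^sup>m\<^sup>+\<^sup>1 (1 - x)\<^sup>n\<^sup>+\<^sup>1\<close> over \<open>[0, 1]\<close> gives zero, which lowers the exponent of
  \<open>1 - x\<close> at the expense of that of \<open>x\<close>.
\<close>
lemma beta_integral_nat:
  "(LINT x:{0..1}|lborel. x ^ m * (1 - x) ^ n) = (fact m * fact n / fact (m + n + 1) :: real)"
proof (induction n arbitrary: m)
  case 0
  have "(LINT x:{0..1}|lborel. x ^ m) = 1 ^ Suc m / real (Suc m) - 0 ^ Suc m / real (Suc m)"
    by (rule set_integral_FTC) (auto intro!: derivative_eq_intros continuous_intros simp del: power_Suc)
  then have "(LINT x:{0..1}|lborel. x ^ m) = 1 / real (Suc m)" by simp
  moreover have "(fact m * fact 0 / fact (m + 0 + 1) :: real) = 1 / real (Suc m)"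
    by (simp add: fact_Suc)
  ultimately show ?case by (simp only: power_0 mult_1_right)
next
  case (Suc n)
  let ?f = "\<lambda>m n x::real. x ^ m * (1 - x) ^ n"
  have int: "set_integrable lborel {0..1} (\<lambda>x. k * ?f m n x)" for k m n
    by (intro set_integrable_continuous_Icc continuous_intros)
  have "(LINT x:{0..1}|lborel. real (Suc m) * ?f m (Suc n) x - real (Suc n) * ?f (Suc m) n x) =
        ?f (Suc m) (Suc n) 1 - ?f (Suc m) (Suc n) 0"
  proof (rule set_integral_FTC)
    fix x :: real
    have "((\<lambda>x. x ^ Suc m) has_real_derivative real (Suc m) * x ^ m) (at x)"
      using DERIV_pow[of "Suc m" x] by simp
    moreover have "((\<lambda>x. (1 - x) ^ Suc n) has_real_derivative - (real (Suc n) * (1 - x) ^ n)) (at x)"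
      by (rule derivative_eq_intros refl)+ simp
    ultimately show "(?f (Suc m) (Suc n) has_real_derivative
        real (Suc m) * ?f m (Suc n) x - real (Suc n) * ?f (Suc m) n x) (at x)"
      by (rule DERIV_cong[OF DERIV_mult]) (simp add: algebra_simps)
  qed (auto intro!: continuous_intros)
  then have "real (Suc m) * (LINT x:{0..1}|lborel. ?f m (Suc n) x) =
             real (Suc n) * (LINT x:{0..1}|lborel. ?f (Suc m) n x)"
    by (subst (asm) set_integral_diff(2)[OF int int]) simp
  also have "\<dots> = real (Suc n) * (fact (Suc m) * fact n / fact (Suc m + n + 1))"
    by (simp only: Suc.IH)
  finally have "(LINT x:{0..1}|lborel. ?f m (Suc n) x) =
      real (Suc n) * (fact (Suc m) * fact n / fact (Suc m + n + 1)) / real (Suc m)"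
    by (subst nonzero_eq_divide_eq) (simp, simp only: mult.commute)
  also have "\<dots> = fact m * fact (Suc n) / fact (m + Suc n + 1)"
    by (simp add: fact_Suc)
  finally show ?case .
qed

lemma beta_integral_binomial:
  assumes "1 \<le> N"
  shows "(LINT x:{0..1}|lborel. x ^ m * (1 - x) ^ (N - 1)) = 1 / (real N * real ((m + N) choose N))"
proof -
  have "real N * real ((m + N) choose N) = fact (m + N) / (fact m * fact (N - 1))"
    using assms fact_reduce[of N, where 'a = real] by (simp add: binomial_fact)
  then show ?thesis using assms by (simp add: beta_integral_nat)
qed

text \<open>
  Expand \<open>(1 - v)\<^sup>n\<close> and integrate the monomials.  The terms of this alternating sum become the
  individual exit probabilities.
\<close>
lemma incomplete_beta_integral:
  assumes "0 \<le> u"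
  shows "(LINT v:{0..u}|lborel. v ^ r * (1 - v) ^ n) =
         (\<Sum>l\<le>n. (-1) ^ l * real (n choose l) / real (l + r + 1) * u ^ (l + r + 1))"
proof -
  have bin: "v ^ r * (1 - v) ^ n = (\<Sum>l\<le>n. (-1) ^ l * real (n choose l) * v ^ (l + r))" for v :: real
    using binomial_ring[of "- v" 1 n]
    by (simp add: sum_distrib_left power_add power_minus[of v] algebra_simps)
  let ?F = "\<lambda>v. \<Sum>l\<le>n. (-1) ^ l * real (n choose l) / real (l + r + 1) * v ^ (l + r + 1)"
  have "(LINT v:{0..u}|lborel. \<Sum>l\<le>n. (-1) ^ l * real (n choose l) * v ^ (l + r)) = ?F u - ?F 0"
  proof (rule set_integral_FTC)
    fix v :: real
    have "((\<lambda>v. (-1) ^ l * real (n choose l) / real (l + r + 1) * v ^ (l + r + 1)) has_real_derivative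
           (-1) ^ l * real (n choose l) * v ^ (l + r)) (at v)" for l
      by (rule derivative_eq_intros refl)+ (simp add: field_simps)
    then show "(?F has_real_derivative (\<Sum>l\<le>n. (-1) ^ l * real (n choose l) * v ^ (l + r))) (at v)"
      by (intro DERIV_sum)
  qed (auto intro!: continuous_intros assms)
  then show ?thesis by (simp add: bin)
qed

text \<open>
  The integrand with the natural exponents \<open>p = -a - 1\<close> and \<open>r = b - 1\<close>.
\<close>
definition beta_density :: "nat \<Rightarrow> nat \<Rightarrow> nat \<Rightarrow> real \<times> real \<Rightarrow> real" where
  "beta_density N p r = (\<lambda>(u, v). u ^ p * (1 - u) ^ (N - 1) * v ^ r * (1 - v) ^ (N - 1))"

text \<open>
  Fubini: the inner integral over \<open>v\<close> is an incomplete beta integral and thus a sum of powers of \<open>u\<close>,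
  each of which turns the outer integral into a complete one.
\<close>
lemma beta_density_lower_triangle:
  assumes N: "1 \<le> N"
  shows "(LINT x : {(u, v). 0 \<le> v \<and> v \<le> u \<and> u \<le> 1} | lborel. beta_density N p r x) =
    (\<Sum>l<N. (-1) ^ l * real ((N - 1) choose l) / real (l + r + 1) / (real N * real ((l + r + 1 + p + N) choose N)))"
proof -
  let ?D = "{(u, v). 0 \<le> v \<and> v \<le> u \<and> u \<le> (1::real)}"
  let ?f = "beta_density N p r" and ?n = "N - 1"
  let ?c = "\<lambda>l. (-1) ^ l * real (?n choose l) / real (l + r + 1)"
  have "?D = {x. 0 \<le> snd x} \<inter> {x. snd x \<le> fst x} \<inter> {x. fst x \<le> 1}" by auto
  then have "closed ?D" by (auto intro!: closed_Int closed_Collect_le continuous_intros)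
  moreover have "bounded ?D"
  proof (rule bounded_subset)
    show "bounded (cbox (0, 0) (1, 1 :: real))" by (rule bounded_cbox)
    show "?D \<subseteq> cbox (0, 0) (1, 1)" by (auto simp: cbox_Pair_eq)
  qed
  ultimately have D: "compact ?D" by (simp add: compact_eq_bounded_closed)
  have int: "integrable (lborel \<Otimes>\<^sub>M lborel) (\<lambda>x. indicator ?D x *\<^sub>R ?f x)"
    unfolding lborel_prod
  proof (rule borel_integrable_compact[OF D])
    show "continuous_on ?D ?f"
      unfolding beta_density_def case_prod_beta by (intro continuous_intros)
  qed
  have inner: "(\<integral>v. indicator ?D (u, v) *\<^sub>R ?f (u, v) \<partial>lborel) =
       indicator {0..1} u *\<^sub>R (\<Sum>l<N. ?c l * (u ^ (l + r + 1 + p) * (1 - u) ^ ?n))" for u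
  proof (cases "u \<in> {0..1}")
    case True
    have "(\<integral>v. indicator ?D (u, v) *\<^sub>R ?f (u, v) \<partial>lborel) =
          (LINT v:{0..u}|lborel. (u ^ p * (1 - u) ^ ?n) * (v ^ r * (1 - v) ^ ?n))"
      unfolding set_lebesgue_integral_def using True
      by (intro Bochner_Integration.integral_cong) (auto simp: indicator_def beta_density_def)
    also have "\<dots> = (u ^ p * (1 - u) ^ ?n) * (\<Sum>l\<le>?n. ?c l * u ^ (l + r + 1))"
      using True by (simp only: set_integral_mult_right incomplete_beta_integral atLeastAtMost_iff)
    also have "{..?n} = {..<N}" using N by auto
    finally show ?thesis using True by (simp add: sum_distrib_left power_add algebra_simps)
  next
    case False
    then have "indicator ?D (u, v) = (0::real)" for v by (auto simp: indicator_def)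
    with False show ?thesis by simp
  qed
  have "(LINT x : ?D | lborel. ?f x) = (\<integral>u. (\<integral>v. indicator ?D (u, v) *\<^sub>R ?f (u, v) \<partial>lborel) \<partial>lborel)"
    unfolding set_lebesgue_integral_def lborel_pair.integral_fst'[OF int] lborel_prod ..
  also have "\<dots> = (LINT u:{0..1}|lborel. \<Sum>l<N. ?c l * (u ^ (l + r + 1 + p) * (1 - u) ^ ?n))"
    unfolding inner set_lebesgue_integral_def ..
  also have "\<dots> = (\<Sum>l<N. LINT u:{0..1}|lborel. ?c l * (u ^ (l + r + 1 + p) * (1 - u) ^ ?n))"
    unfolding set_lebesgue_integral_def scaleR_sum_right
    by (intro Bochner_Integration.integral_sum
        set_integrable_continuous_Icc[unfolded set_integrable_def] continuous_intros)
  also have "\<dots> = (\<Sum>l<N. ?c l * (1 / (real N * real ((l + r + 1 + p + N) choose N))))"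
    by (simp only: set_integral_mult_right beta_integral_binomial[OF N])
  finally show ?thesis by simp
qed

text \<open>
  Reflecting at the diagonal exchanges the two triangles, and with them the exponents.
\<close>
lemma beta_density_upper_triangle:
  "(LINT x : {(u, v). 0 \<le> u \<and> u \<le> v \<and> v \<le> 1} | lborel. beta_density N p r x) =
   (LINT x : {(u, v). 0 \<le> v \<and> v \<le> u \<and> u \<le> 1} | lborel. beta_density N r p x)"
proof -
  let ?D = "{(u, v). 0 \<le> v \<and> v \<le> u \<and> u \<le> (1::real)}"
  let ?E = "{(u, v). 0 \<le> u \<and> u \<le> v \<and> v \<le> (1::real)}"
  let ?g = "\<lambda>x. indicator ?E x *\<^sub>R beta_density N p r x"
  have "?E = {x. 0 \<le> fst x} \<inter> {x. fst x \<le> snd x} \<inter> {x. snd x \<le> 1}" by auto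
  then have E: "closed ?E" by (auto intro!: closed_Int closed_Collect_le continuous_intros)
  have "beta_density N p r \<in> borel_measurable borel"
    unfolding beta_density_def case_prod_beta
    by (intro borel_measurable_continuous_onI continuous_intros)
  then have "?g \<in> borel_measurable (lborel \<Otimes>\<^sub>M lborel)"
    unfolding lborel_prod using E by (auto intro!: borel_measurable_scaleR borel_measurable_indicator)
  from lborel_pair.integral_product_swap[OF this]
  have "integral\<^sup>L lborel ?g = (\<integral>x. (case x of (u, v) \<Rightarrow> ?g (v, u)) \<partial>lborel)"
    by (simp only: lborel_prod)
  also have "(\<lambda>x. case x of (u, v) \<Rightarrow> ?g (v, u)) = (\<lambda>x. indicator ?D x *\<^sub>R beta_density N r p x)"
    by (auto simp: fun_eq_iff indicator_def beta_density_def)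
  finally show ?thesis by (simp only: set_lebesgue_integral_def)
qed

lemma sum_exit_prob_above:
  assumes N: "1 \<le> N" and c: "0 < c" and a: "a < 0" and b: "0 < b"
  shows "prob_above_before_below N c a b = exit_const N a b * (real N)\<^sup>2 *
    (LINT x : {(u, v). 0 \<le> v \<and> v \<le> u \<and> u \<le> 1} | lborel. beta_density N (nat (- a - 1)) (nat (b - 1)) x)"
proof -
  define p r where "p = nat (- a - 1)" and "r = nat (b - 1)"
  have bin: "nat (int l + b - a + int N - 1) = l + r + 1 + p + N" for l
    using a b by (simp add: p_def r_def)
  have den: "real_of_int (int l + b) = real (l + r + 1)" for l
    using b by (simp add: r_def)
  have "prob_above_before_below N c a b = (\<Sum>l<N. exit_prob N c a b (b + int l))"
    unfolding prob_above_before_below_def upper_block by (subst sum.reindex) (auto simp: inj_on_def)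
  also have "\<dots> = (\<Sum>l<N. exit_const N a b * (real N)\<^sup>2 *
      ((-1) ^ l * real ((N - 1) choose l) / real (l + r + 1) / (real N * real ((l + r + 1 + p + N) choose N))))"
    using N by (intro sum.cong refl) (simp only: exit_prob_upper[OF N c a b] lessThan_iff bin den, simp add: power2_eq_square)
  finally show ?thesis
    by (simp only: beta_density_lower_triangle[OF N] sum_distrib_left p_def r_def)
qed

lemma sum_exit_prob_below:
  assumes N: "1 \<le> N" and c: "0 < c" and a: "a < 0" and b: "0 < b"
  shows "prob_below_before_above N c a b = exit_const N a b * (real N)\<^sup>2 *
    (LINT x : {(u, v). 0 \<le> u \<and> u \<le> v \<and> v \<le> 1} | lborel. beta_density N (nat (- a - 1)) (nat (b - 1)) x)"
proof -
  define p r where "p = nat (- a - 1)" and "r = nat (b - 1)"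
  have bin: "nat (int l + b - a + int N - 1) = l + p + 1 + r + N" for l
    using a b by (simp add: p_def r_def)
  have den: "real_of_int (int l - a) = real (l + p + 1)" for l
    using a by (simp add: p_def)
  have "prob_below_before_above N c a b = (\<Sum>l<N. exit_prob N c a b (a - int l))"
    unfolding prob_below_before_above_def lower_block by (subst sum.reindex) (auto simp: inj_on_def)
  also have "\<dots> = (\<Sum>l<N. exit_const N a b * (real N)\<^sup>2 *
      ((-1) ^ l * real ((N - 1) choose l) / real (l + p + 1) / (real N * real ((l + p + 1 + r + N) choose N))))"
    using N by (intro sum.cong refl) (simp only: exit_prob_lower[OF N c a b] lessThan_iff bin den, simp add: power2_eq_square)
  finally show ?thesis
    by (simp only: beta_density_upper_triangle beta_density_lower_triangle[OF N] sum_distrib_left p_def r_def)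
qed


section \<open>The exit law of the pseudo-random walk\<close>

theorem theorem8p6:
  fixes N :: nat and c :: real and a b :: int
  assumes "1 \<le> N" and "0 < c" and "a < 0" and "0 < b"
  shows "(\<forall>l\<in>exit_set N a b. \<exists>!p. has_exit_prob N c a b l p)
    \<and> (\<forall>l<N. exit_prob N c a b (a - int l) =
          (-1) ^ l * (exit_const N a b * real N / real_of_int (int l - a)) * real ((N - 1) choose l)
            / real (nat (int l + b - a + int N - 1) choose N))
    \<and> (\<forall>l<N. exit_prob N c a b (b + int l) =
          (-1) ^ l * (exit_const N a b * real N / real_of_int (int l + b)) * real ((N - 1) choose l)
            / real (nat (int l + b - a + int N - 1) choose N))
    \<and> exit_const N a b =
          (-1) ^ N / (fact N)\<^sup>2 * (\<Prod>j<N. real_of_int (a - int j)) * (\<Prod>j<N. real_of_int (b + int j))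
    \<and> prob_exit_finite N c a b = 1
    \<and> prob_above_before_below N c a b =
          exit_const N a b * (real N)\<^sup>2 *
          (LINT (u, v) : {(u, v). 0 \<le> v \<and> v \<le> u \<and> u \<le> 1} | lborel.
             u powi (- a - 1) * (1 - u) ^ (N - 1) * v powi (b - 1) * (1 - v) ^ (N - 1))
    \<and> prob_below_before_above N c a b =
          exit_const N a b * (real N)\<^sup>2 *
          (LINT (u, v) : {(u, v). 0 \<le> u \<and> u \<le> v \<and> v \<le> 1} | lborel.
             u powi (- a - 1) * (1 - u) ^ (N - 1) * v powi (b - 1) * (1 - v) ^ (N - 1))"
proof -
  note hyps = assms
  have "\<exists>!p. has_exit_prob N c a b l p" if "l \<in> exit_set N a b" for l
  proof -
    have "l \<le> a \<or> b \<le> l" using that by (auto simp: exit_set_def)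
    then have "\<exists>p. has_exit_prob N c a b l p"
      using exit_prob_exists[OF hyps] by metis
    then show ?thesis using has_exit_prob_unique[OF assms(1)] by blast
  qed
  moreover have "prob_exit_finite N c a b = 1"
    using exit_prob_interpolation[OF hyps, of 1] assms(1) by (simp add: prob_exit_finite_def)
  moreover have "(\<lambda>(u, v). u powi (- a - 1) * (1 - u) ^ (N - 1) * v powi (b - 1) * (1 - v) ^ (N - 1)) =
      beta_density N (nat (- a - 1)) (nat (b - 1))"
    using assms(3,4) by (auto simp: beta_density_def power_int_def fun_eq_iff)
  ultimately show ?thesis
    using exit_prob_lower[OF hyps] exit_prob_upper[OF hyps] exit_const_rising[OF assms(3,4)]
      sum_exit_prob_above[OF hyps] sum_exit_prob_below[OF hyps]
    by simp
qed

end
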